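(* Consider the MTLS problem with the data, standing assumptions and notation given in the context, and assume that one of the genericity conditions (G1) or (G2) of the context holds. Let $x=x_{\rm M}$ be the MTLS solution, $r=Ax-b$, $P=A^TA-\tilde\sigma_{n_2+1}^2W$ and $H_0=I_m-\frac{2rr^T}{\|r\|_2^2}$. Then the mixed condition number $m(A,b)$ and the componentwise condition number $c(A,b)$ of the MTLS problem are bounded as $$m(A,b)\le\frac{\big\|\,|P^{-1}A^TH_0|\,(|A||x|+|b|)+|P^{-1}||A^T||r|\,\big\|_\infty}{\|x\|_\infty},$$ $$c(A,b)\le\Bigg\|\frac{|P^{-1}A^TH_0|\,(|A||x|+|b|)+|P^{-1}||A^T||r|}{|x|}\Bigg\|_\infty .$$
   Context: Data and standing assumptions: $A\in\mathbb{R}^{m\times n}$, $m\ge n$, has full column rank, $b\in\mathbb{R}^m$, and $Ax=b$ is not consistent. $A=[A_1,A_2]$ with $A_1\in\mathbb{R}^{m\times n_1}$ (columns known exactly), $A_2\in\mathbb{R}^{m\times n_2}$, $n_1+n_2=n$; vectors $x=[x_1^T,x_2^T]^T$ are partitioned conformally. The MTLS problem is $\min_{E_2,f}\|[E_2,f]\|_F$ subject to $A_1x_1+(A_2+E_2)x_2=b+f$. An MTLS solution is a vector $x\in\mathbb{R}^n$ satisfying the constraint for some $(E_2,f)$ attaining the minimum over all triples $(E_2,f,x)$ satisfying the constraint; it is denoted $x_{\rm M}$ when unique. It is assumed that $[A,b]$ and $x_{\rm M}$ have no zero entries. QR factorization: for an orthogonal $Q\in\mathbb{R}^{m\times m}$,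 $Q^T[A_1,A_2,b]=\begin{bmatrix}R_{11}&R_{12}&R_{1b}\\0&R_{22}&R_{2b}\end{bmatrix}$, upper triangular, with row blocks of sizes $n_1$, $m-n_1$ and column blocks of sizes $n_1,n_2,1$. Put $W=\mathrm{diag}(O_{n_1},I_{n_2})$, $\tilde W=\mathrm{diag}(W,1)$, $\tilde A=[A,b]$, and $\tilde\sigma_{n_2+1}=\sigma_{n_2+1}([R_{22},R_{2b}])$. Genericity conditions: (G1) $\sigma_{n_2}(R_{22})>\sigma_{n_2+1}([R_{22},R_{2b}])>0$; (G2) $\lambda_n(A^TA,W)>\lambda_{n+1}(\tilde A^T\tilde A,\tilde W)$. Here $\sigma_i$ is the $i$-th largest singular value (if $n_2=0$, read $\sigma_0=+\infty$), and $\lambda_i(M,N)$ is the $i$-th largest generalized eigenvalue of the pair $(M,N)$, infinite eigenvalues (arising when $N$ is singular) being counted first. One has $\tilde\sigma_{n_2+1}^2=\lambda_{n+1}(\tilde A^T\tilde A,\tilde W)$, and under (G1) or (G2) the MTLS solution is unique and given by $x_{\rm M}=(A^TA-\tilde\sigma_{n_2+1}^2W)^{-1}A^Tb$. Condition numbers: let $a=\mathrm{vec}([A,b])$ and let $\phi$ be the map $a\mapsto x_{\rm M}$ (defined near $a$), $\delta x=\phi(a+\delta a)-\phi(a)$. Then $$m(A,b)=\lim_{\varepsilon\to0}\sup_{|\delta a|\le\varepsilon|a|}\frac{\|\delta x\|_\infty/\|x\|_\infty}{\|\delta a/a\|_\infty}=\frac{\big\|\,|K|\,\mathrm{vec}([|A|,|b|])\big\|_\infty}{\|x\|_\infty},$$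 $$c(A,b)=\lim_{\varepsilon\to0}\sup_{|\delta a|\le\varepsilon|a|}\frac{\|\delta x/x\|_\infty}{\|\delta a/a\|_\infty}=\left\|\frac{|K|\,\mathrm{vec}([|A|,|b|])}{|x|}\right\|_\infty,$$ the suprema being over $\delta a\ne0$, where $$K=\phi'(a)=-P^{-1}\Big(A^TH_0\,([x^T,-1]\otimes I_m)+[\,I_n\otimes r^T,\ O_{n\times m}\,]\Big).$$ Notation: $|\cdot|$ is the entrywise absolute value, inequalities and quotients of vectors are entrywise; $\|\cdot\|_\infty$ is the $\infty$-norm; $\mathrm{vec}(\cdot)$ stacks the columns of a matrix; $\otimes$ is the Kronecker product, $A\otimes B=[a_{ij}B]$; $O_{p\times q}$ is the zero matrix. *)

theory Defs
  imports
    "HOL-Library.Extended_Real"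
    "Jordan_Normal_Form.Gauss_Jordan_Elimination"
    "Jordan_Normal_Form.Char_Poly"
    "Jordan_Normal_Form.DL_Rank"
begin

subsection \<open>Vectors and matrices\<close>

abbreviation vec_abs :: "real vec \<Rightarrow> real vec" where
  "vec_abs \<equiv> map_vec abs"

abbreviation mat_abs :: "real mat \<Rightarrow> real mat" where
  "mat_abs \<equiv> map_mat abs"

definition vec_quot :: "real vec \<Rightarrow> real vec \<Rightarrow> real vec" where
  "vec_quot u v = vec (dim_vec u) (\<lambda>i. u $ i / v $ i)"

text \<open>The inserted \<open>0\<close> only matters for vectors of dimension \<open>0\<close>.\<close>

definition norm_inf :: "real vec \<Rightarrow> real" where
  "norm_inf v = Max (insert 0 ((\<lambda>i. \<bar>v $ i\<bar>) ` {..<dim_vec v}))"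

definition norm2 :: "real vec \<Rightarrow> real" where
  "norm2 v = sqrt (v \<bullet> v)"

definition norm_frob :: "real mat \<Rightarrow> real" where
  "norm_frob M = sqrt (\<Sum>i<dim_row M. \<Sum>j<dim_col M. (M $$ (i, j))\<^sup>2)"

definition append_cols :: "real mat \<Rightarrow> real mat \<Rightarrow> real mat" (infixr "@\<^sub>c" 65) where
  "M @\<^sub>c N = mat_of_cols (dim_row M) (cols M @ cols N)"

definition col_mat :: "real vec \<Rightarrow> real mat" where
  "col_mat v = mat_of_cols (dim_vec v) [v]"

text \<open>Column-stacking, with 0-based indices: entry \<open>(i, j)\<close> of a matrix with \<open>m\<close> rows goes to
  position \<open>j * m + i\<close>.\<close>

definition vec_of_mat :: "real mat \<Rightarrow> real vec" where
  "vec_of_mat M =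
     vec (dim_row M * dim_col M) (\<lambda>k. M $$ (k mod dim_row M, k div dim_row M))"

definition mat_inv :: "real mat \<Rightarrow> real mat" where
  "mat_inv M = the (mat_inverse M)"


subsection \<open>Singular values and generalized eigenvalues\<close>

definition desc_roots :: "real poly \<Rightarrow> real list" where
  "desc_roots p = rev (sorted_list_of_multiset (proots p))"

text \<open>The \<open>i\<close>-th largest singular value, counted with multiplicity from \<open>i = 1\<close>; meaningful for
  \<open>1 \<le> i \<le> min (dim_row M) (dim_col M)\<close>.\<close>

definition sing_val :: "nat \<Rightarrow> real mat \<Rightarrow> real" where
  "sing_val i M = sqrt (desc_roots (char_poly (M\<^sup>T * M)) ! (i - 1))"

text \<open>The characteristic polynomial \<open>det (M - \<lambda> N)\<close> of the pair \<open>(M, N)\<close>. If it is nonzero, its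
  degree falls short of the size of \<open>M\<close> by the multiplicity of the eigenvalue \<open>\<infinity>\<close>.\<close>

definition gen_char_poly :: "real mat \<Rightarrow> real mat \<Rightarrow> real poly" where
  "gen_char_poly M N = det (map_mat (\<lambda>a. [:a:]) M - map_mat (\<lambda>a. [:0, a:]) N)"

definition gen_eigs :: "real mat \<Rightarrow> real mat \<Rightarrow> ereal list" where
  "gen_eigs M N = replicate (dim_row M - degree (gen_char_poly M N)) \<infinity>
                  @ map ereal (desc_roots (gen_char_poly M N))"

definition gen_eig :: "nat \<Rightarrow> real mat \<Rightarrow> real mat \<Rightarrow> ereal" where
  "gen_eig i M N = gen_eigs M N ! (i - 1)"


subsection \<open>The MTLS problem\<close>

definition mtls_feasible ::
  "real mat \<Rightarrow> real mat \<Rightarrow> real vec \<Rightarrow> real mat \<Rightarrow> real vec \<Rightarrow> real vec \<Rightarrow> bool" where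
  "mtls_feasible A1 A2 b E f x \<longleftrightarrow>
     E \<in> carrier_mat (dim_row A2) (dim_col A2) \<and> f \<in> carrier_vec (dim_vec b) \<and>
     x \<in> carrier_vec (dim_col A1 + dim_col A2) \<and>
     A1 *\<^sub>v vec_first x (dim_col A1) + (A2 + E) *\<^sub>v vec_last x (dim_col A2) = b + f"

definition mtls_solution :: "real mat \<Rightarrow> real mat \<Rightarrow> real vec \<Rightarrow> real vec \<Rightarrow> bool" where
  "mtls_solution A1 A2 b x \<longleftrightarrow>
     (\<exists>E f. mtls_feasible A1 A2 b E f x \<and>
        (\<forall>E' f' x'. mtls_feasible A1 A2 b E' f' x' \<longrightarrow>
           norm_frob (E @\<^sub>c col_mat f) \<le> norm_frob (E' @\<^sub>c col_mat f')))"

definition x_mtls :: "real mat \<Rightarrow> real mat \<Rightarrow> real vec \<Rightarrow> real vec" where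
  "x_mtls A1 A2 b = (THE x. mtls_solution A1 A2 b x)"

text \<open>The solution as a function of the stacked data \<open>a = vec [A1, A2, b]\<close>; unspecified where the
  solution does not exist or is not unique.\<close>

definition mtls_map :: "nat \<Rightarrow> nat \<Rightarrow> nat \<Rightarrow> real vec \<Rightarrow> real vec" where
  "mtls_map m n1 n2 a =
     (THE x. \<exists>A1 A2 b. A1 \<in> carrier_mat m n1 \<and> A2 \<in> carrier_mat m n2 \<and> b \<in> carrier_vec m \<and>
        a = vec_of_mat (A1 @\<^sub>c A2 @\<^sub>c col_mat b) \<and> mtls_solution A1 A2 b x)"

definition mtls_qr ::
  "real mat \<Rightarrow> real mat \<Rightarrow> real vec \<Rightarrow> real mat \<Rightarrow>
   real mat \<Rightarrow> real mat \<Rightarrow> real vec \<Rightarrow> real mat \<Rightarrow> real vec \<Rightarrow> bool" where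
  "mtls_qr A1 A2 b Q R11 R12 R1b R22 R2b \<longleftrightarrow>
     (let m = dim_vec b; n1 = dim_col A1; n2 = dim_col A2;
          R = Q\<^sup>T * (A1 @\<^sub>c A2 @\<^sub>c col_mat b)
      in Q \<in> carrier_mat m m \<and> Q\<^sup>T * Q = 1\<^sub>m m \<and>
         R11 \<in> carrier_mat n1 n1 \<and> R12 \<in> carrier_mat n1 n2 \<and> R1b \<in> carrier_vec n1 \<and>
         R22 \<in> carrier_mat (m - n1) n2 \<and> R2b \<in> carrier_vec (m - n1) \<and>
         R = four_block_mat R11 (R12 @\<^sub>c col_mat R1b)
                            (0\<^sub>m (m - n1) n1) (R22 @\<^sub>c col_mat R2b) \<and>
         (\<forall>i<dim_row R. \<forall>j<dim_col R. j < i \<longrightarrow> R $$ (i, j) = 0))"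

definition mtls_W :: "nat \<Rightarrow> nat \<Rightarrow> real mat" where
  "mtls_W n1 n2 = diag_block_mat [0\<^sub>m n1 n1, 1\<^sub>m n2]"

definition mtls_W' :: "nat \<Rightarrow> nat \<Rightarrow> real mat" where
  "mtls_W' n1 n2 = diag_block_mat [mtls_W n1 n2, 1\<^sub>m 1]"

text \<open>The disjunct \<open>dim_col R22 = 0\<close> reads the \<open>0\<close>-th singular value as \<open>\<infinity>\<close>.\<close>

definition mtls_generic1 :: "real mat \<Rightarrow> real vec \<Rightarrow> bool" where
  "mtls_generic1 R22 R2b \<longleftrightarrow>
     (let n2 = dim_col R22; s = sing_val (n2 + 1) (R22 @\<^sub>c col_mat R2b)
      in (n2 = 0 \<or> sing_val n2 R22 > s) \<and> s > 0)"

definition mtls_generic2 :: "real mat \<Rightarrow> real mat \<Rightarrow> real vec \<Rightarrow> bool" where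
  "mtls_generic2 A1 A2 b \<longleftrightarrow>
     (let n1 = dim_col A1; n2 = dim_col A2; n = n1 + n2;
          A = A1 @\<^sub>c A2; A' = A @\<^sub>c col_mat b
      in gen_eig n (A\<^sup>T * A) (mtls_W n1 n2) > gen_eig (n + 1) (A'\<^sup>T * A') (mtls_W' n1 n2))"


subsection \<open>Condition numbers\<close>

text \<open>The admissible relative perturbations of \<open>a\<close>.\<close>

definition perturbs :: "real vec \<Rightarrow> real \<Rightarrow> real vec set" where
  "perturbs a \<epsilon> = {d \<in> carrier_vec (dim_vec a). d \<noteq> 0\<^sub>v (dim_vec a) \<and> vec_abs d \<le> \<epsilon> \<cdot>\<^sub>v vec_abs a}"

text \<open>The suprema are taken in \<open>ereal\<close>, so they exist even if the quotients are unbounded; being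
  monotone in \<open>\<epsilon>\<close>, they always have a limit as \<open>\<epsilon>\<close> tends to \<open>0\<close> from above.\<close>

definition mixed_cond :: "(real vec \<Rightarrow> real vec) \<Rightarrow> real vec \<Rightarrow> ereal" where
  "mixed_cond \<phi> a = Lim (at_right 0) (\<lambda>\<epsilon>. SUP d \<in> perturbs a \<epsilon>.
     ereal (norm_inf (\<phi> (a + d) - \<phi> a) / norm_inf (\<phi> a) / norm_inf (vec_quot d a)))"

definition componentwise_cond :: "(real vec \<Rightarrow> real vec) \<Rightarrow> real vec \<Rightarrow> ereal" where
  "componentwise_cond \<phi> a = Lim (at_right 0) (\<lambda>\<epsilon>. SUP d \<in> perturbs a \<epsilon>.
     ereal (norm_inf (vec_quot (\<phi> (a + d) - \<phi> a) (\<phi> a)) / norm_inf (vec_quot d a)))"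

definition mtls_mixed_cond :: "real mat \<Rightarrow> real mat \<Rightarrow> real vec \<Rightarrow> ereal" where
  "mtls_mixed_cond A1 A2 b =
     mixed_cond (mtls_map (dim_vec b) (dim_col A1) (dim_col A2))
                (vec_of_mat (A1 @\<^sub>c A2 @\<^sub>c col_mat b))"

definition mtls_componentwise_cond :: "real mat \<Rightarrow> real mat \<Rightarrow> real vec \<Rightarrow> ereal" where
  "mtls_componentwise_cond A1 A2 b =
     componentwise_cond (mtls_map (dim_vec b) (dim_col A1) (dim_col A2))
                        (vec_of_mat (A1 @\<^sub>c A2 @\<^sub>c col_mat b))"

end

theory Submission
  imports Defs "HOL-Analysis.Function_Topology" "HOL-Analysis.L2_Norm"
begin

text \<open>
  For a fixed \<open>x\<close> with residual \<open>r = A x - b\<close>, a correction \<open>(E, f)\<close> is feasible iff each row of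
  \<open>[E, f]\<close> maps \<open>(x\<^sub>2, -1)\<close> to minus the corresponding entry of \<open>r\<close>. By Cauchy-Schwarz the cheapest such
  correction has squared norm \<open>|r|\<^sup>2 / (1 + |x\<^sub>2|\<^sup>2)\<close>. With \<open>z = (x, -1)\<close> this is the Rayleigh quotient of the
  pencil \<open>([A, b]\<^sup>T [A, b], diag(W, 1))\<close>, so that MTLS solutions are the minimizers of this quotient among the
  vectors with last entry \<open>-1\<close> (\<open>mtls_solution_iff_minimizer\<close>).

  The triangular factor splits \<open>|[A, b] z|\<^sup>2\<close> into a square that \<open>x\<^sub>1\<close> can annihilate and
  \<open>|[R\<^sub>2\<^sub>2, R\<^sub>2\<^sub>b] (x\<^sub>2, -1)|\<^sup>2\<close>. The infimum of the quotient is therefore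
  the smallest eigenvalue \<open>\<sigma>\<^sup>2\<close> of the Gram matrix of \<open>[R\<^sub>2\<^sub>2, R\<^sub>2\<^sub>b]\<close>, and either genericity condition places it strictly below the smallest
  eigenvalue of the Gram matrix of \<open>R\<^sub>2\<^sub>2\<close>; the second one because the determinant of the pencil factors through these
  Gram matrices (\<open>gen_eig_last\<close>). Hence the form \<open>S = [A, b]\<^sup>T [A, b] - \<sigma>\<^sup>2 diag(W, 1)\<close> is positive
  semidefinite, it vanishes at some \<open>z\<close> with last entry \<open>-1\<close>, and its restriction \<open>P\<close> to the vectors with last entry
  \<open>0\<close> is positive definite (\<open>generic_minimizer\<close>). As \<open>S\<close> takes the value \<open>h\<^sup>T P h\<close> at \<open>z + h\<close>, the minimizer is unique, and
  small perturbations of the data keep a unique minimizer near it (\<open>minimizer_stable\<close>).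

  No differentiability of the solution map is used. If \<open>z'\<close> and \<open>S'\<close> belong to perturbed data, subtracting
  \<open>S z = 0\<close> from \<open>S' z' = 0\<close> gives an exact identity for \<open>P (x' - x)\<close> whose right-hand side is linear in the
  perturbation of \<open>[A, b]\<close>, with coefficients that are continuous in \<open>z'\<close> (\<open>minimizer_difference\<close>). As \<open>z'\<close> tends to \<open>z\<close> the
  coefficients tend to those of the formal derivative of the solution map, where \<open>A\<^sup>T r = \<sigma>\<^sup>2 W x\<close> and \<open>|r|\<^sup>2 = \<sigma>\<^sup>2 (1 + |x\<^sub>2|\<^sup>2)\<close>
  produce the reflection \<open>H\<^sub>0\<close> (\<open>sens_limit\<close>). If every entry of \<open>[A, b]\<close> changes by a relative amount of at most \<open>\<eta>\<close>, the triangle inequality then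
  bounds entry \<open>j\<close> of \<open>x' - x\<close> by \<open>\<eta> (u\<^sub>j + o(1))\<close> (\<open>minimizer_sensitivity\<close>), and bounds of this kind
  limit both condition numbers (\<open>condition_numbers_le\<close>).
\<close>

section \<open>Minima of quadratic functions of finitely many coordinates\<close>

lemma compact_coordinate_box:
  fixes l u :: "nat \<Rightarrow> real"
  shows "compact {y. \<forall>j. l j \<le> y j \<and> y j \<le> u j}"
proof -
  have "compactin (product_topology (\<lambda>_. euclidean) UNIV) (Pi\<^sub>E UNIV (\<lambda>j. {l j..u j}))"
    by (subst compactin_PiE) (auto simp: compactin_euclidean_iff)
  moreover have "Pi\<^sub>E UNIV (\<lambda>j. {l j..u j}) = {y. \<forall>j. l j \<le> y j \<and> y j \<le> u j}"
    by (auto simp: PiE_def Pi_def)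
  ultimately show ?thesis
    by (simp add: euclidean_product_topology compactin_euclidean_iff)
qed

lemma continuous_on_coordinate [continuous_intros]:
  "continuous_on S (\<lambda>y :: nat \<Rightarrow> real. y j)"
  by (rule continuous_on_subset[OF continuous_on_product_coordinates]) auto

lemma abs_le_sqrt_sum_squares:
  fixes h :: "nat \<Rightarrow> real"
  assumes "finite I" "j \<in> I"
  shows "\<bar>h j\<bar> \<le> sqrt (\<Sum>i\<in>I. (h i)\<^sup>2)"
proof -
  have "(h j)\<^sup>2 \<le> (\<Sum>i\<in>I. (h i)\<^sup>2)"
    using assms by (intro member_le_sum) auto
  then show ?thesis
    by (metis real_sqrt_abs real_sqrt_le_iff)
qed

text \<open>
  The unit sphere is compact, and homogeneity carries the bound from the sphere to all vectors.
\<close>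

lemma quadratic_attains_min_on_sphere:
  fixes f :: "(nat \<Rightarrow> real) \<Rightarrow> real"
  assumes "0 < n"
    and cont: "continuous_on UNIV f"
    and hom: "\<And>t h. f (\<lambda>j. t * h j) = t\<^sup>2 * f h"
    and loc: "\<And>h g. (\<And>j. j < n \<Longrightarrow> h j = g j) \<Longrightarrow> f h = f g"
  obtains e where "(\<Sum>j<n. (e j)\<^sup>2) = 1" "\<And>h. f e * (\<Sum>j<n. (h j)\<^sup>2) \<le> f h"
proof -
  define b :: "nat \<Rightarrow> real" where "b j = (if j < n then 1 else 0)" for j
  define K where "K = {y. \<forall>j. - b j \<le> y j \<and> y j \<le> b j} \<inter> {y. (\<Sum>j<n. (y j)\<^sup>2) = 1}"
  have "closed {y :: nat \<Rightarrow> real. (\<Sum>j<n. (y j)\<^sup>2) = 1}"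
    by (intro closed_Collect_eq continuous_intros)
  then have "compact K"
    unfolding K_def by (intro compact_Int_closed compact_coordinate_box)
  moreover have "(\<lambda>j. if j = 0 then 1 else 0) \<in> K"
  proof -
    have "(\<Sum>j<n. (if j = 0 then 1 else 0 :: real)\<^sup>2) = (\<Sum>j<n. if j = 0 then 1 else 0)"
      by (intro sum.cong) auto
    then show ?thesis
      using \<open>0 < n\<close> by (auto simp: K_def b_def)
  qed
  moreover have "continuous_on K f"
    using cont continuous_on_subset by blast
  ultimately obtain e where e: "e \<in> K" and min: "\<And>y. y \<in> K \<Longrightarrow> f e \<le> f y"
    using continuous_attains_inf[of K f] by blast
  have "f e * (\<Sum>j<n. (h j)\<^sup>2) \<le> f h" for h
  proof (cases "(\<Sum>j<n. (h j)\<^sup>2) = 0")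
    case True
    then have "h j = 0 * h j" if "j < n" for j
      using that by (simp add: sum_nonneg_eq_0_iff)
    then have "f h = 0\<^sup>2 * f h"
      using loc[of h "\<lambda>j. 0 * h j"] hom[of 0 h] by simp
    then show ?thesis
      using True by simp
  next
    case False
    define s where "s = sqrt (\<Sum>j<n. (h j)\<^sup>2)"
    have s: "s > 0" "s\<^sup>2 = (\<Sum>j<n. (h j)\<^sup>2)"
      using False by (simp_all add: s_def sum_nonneg less_le)
    define g where "g j = (if j < n then h j / s else 0)" for j
    have "(\<Sum>j<n. (g j)\<^sup>2) = (\<Sum>j<n. (h j)\<^sup>2) / s\<^sup>2"
      by (simp add: g_def power_divide sum_divide_distrib)
    then have one: "(\<Sum>j<n. (g j)\<^sup>2) = 1"
      using s False by simp
    have "\<bar>g j\<bar> \<le> b j" for j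
      using abs_le_sqrt_sum_squares[of "{..<n}" j g] one by (auto simp: b_def g_def)
    then have "g \<in> K"
      using one by (auto simp: K_def abs_le_iff minus_le_iff)
    then have "f e \<le> f g"
      by (rule min)
    moreover have "f h = s\<^sup>2 * f g"
      using loc[of h "\<lambda>j. s * g j"] hom[of s g] s by (simp add: g_def)
    ultimately show ?thesis
      using s by (metis mult.commute mult_left_mono zero_le_power2)
  qed
  moreover have "(\<Sum>j<n. (e j)\<^sup>2) = 1"
    using e by (simp add: K_def)
  ultimately show thesis
    using that by blast
qed

lemma linear_coeff_zero_if_nonneg:
  fixes a b :: real
  assumes "\<And>t. 0 \<le> 2 * t * a + t\<^sup>2 * b"
  shows "a = 0"
proof (rule ccontr)
  assume "a \<noteq> 0"
  define d where "d = \<bar>b\<bar> + 1"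
  define t where "t = - a / d"
  have d: "b \<le> d" "d > 0"
    by (simp_all add: d_def add_nonneg_pos)
  have "t\<^sup>2 * b \<le> t\<^sup>2 * d"
    using d by (intro mult_left_mono) auto
  also have "\<dots> = a\<^sup>2 / d"
    using d by (simp add: t_def power2_eq_square)
  finally have "2 * t * a + t\<^sup>2 * b \<le> - (a\<^sup>2 / d)"
    by (simp add: t_def power2_eq_square)
  moreover have "a\<^sup>2 / d > 0"
    using \<open>a \<noteq> 0\<close> d by simp
  ultimately show False
    using assms[of t] by simp
qed

section \<open>A Rayleigh quotient on vectors with last entry -1\<close>

text \<open>
  Matrices and vectors are plain functions of their indices here, so that compactness and limits can be taken
  coordinatewise. Columns \<open>0\<close> to \<open>n - 1\<close> of the coefficients play the role of \<open>A\<close>, column \<open>n\<close> that of \<open>b\<close>; a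
  vector \<open>z\<close> with \<open>z n = -1\<close> stands for the candidate solution \<open>(z 0, ..., z (n - 1))\<close>, and \<open>res B z\<close> is
  its residual. The weights are the diagonal of the second matrix of the pencil.
\<close>

locale weighted_residual =
  fixes m n :: nat and w :: "nat \<Rightarrow> real"
  assumes w_nonneg: "0 \<le> w j" and w_last: "w n = 1"
begin

definition res :: "(nat \<Rightarrow> nat \<Rightarrow> real) \<Rightarrow> (nat \<Rightarrow> real) \<Rightarrow> nat \<Rightarrow> real" where
  "res B u i = (\<Sum>j\<le>n. B i j * u j)"

definition gram :: "(nat \<Rightarrow> nat \<Rightarrow> real) \<Rightarrow> (nat \<Rightarrow> real) \<Rightarrow> (nat \<Rightarrow> real) \<Rightarrow> real" where
  "gram B u v = (\<Sum>i<m. res B u i * res B v i)"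

definition wprod :: "(nat \<Rightarrow> real) \<Rightarrow> (nat \<Rightarrow> real) \<Rightarrow> real" where
  "wprod u v = (\<Sum>j\<le>n. w j * u j * v j)"

text \<open>
  The bilinear form of \<open>B\<^sup>T B - \<mu> diag(w)\<close>.
\<close>

definition form :: "real \<Rightarrow> (nat \<Rightarrow> nat \<Rightarrow> real) \<Rightarrow> (nat \<Rightarrow> real) \<Rightarrow> (nat \<Rightarrow> real) \<Rightarrow> real" where
  "form \<mu> B u v = gram B u v - \<mu> * wprod u v"

definition rayleigh :: "(nat \<Rightarrow> nat \<Rightarrow> real) \<Rightarrow> (nat \<Rightarrow> real) \<Rightarrow> real" where
  "rayleigh B z = gram B z z / wprod z z"

definition minimizer :: "(nat \<Rightarrow> nat \<Rightarrow> real) \<Rightarrow> (nat \<Rightarrow> real) \<Rightarrow> bool" where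
  "minimizer B z \<longleftrightarrow> z n = -1 \<and> (\<forall>y. y n = -1 \<longrightarrow> rayleigh B z \<le> rayleigh B y)"

text \<open>
  Definiteness of the leading \<open>n\<close> by \<open>n\<close> block of \<open>B\<^sup>T B - \<mu> diag(w)\<close> only; the full matrix is
  singular for the \<open>\<mu>\<close> of interest. The uniform constant \<open>c\<close> is what survives a perturbation.
\<close>

definition pos_def :: "real \<Rightarrow> (nat \<Rightarrow> nat \<Rightarrow> real) \<Rightarrow> bool" where
  "pos_def \<mu> B \<longleftrightarrow> (\<exists>c>0. \<forall>h. h n = 0 \<longrightarrow> c * (\<Sum>j\<le>n. (h j)\<^sup>2) \<le> form \<mu> B h h)"

lemma res_add: "res B (\<lambda>j. u j + v j) i = res B u i + res B v i"
  by (simp add: res_def algebra_simps sum.distrib)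

lemma res_scale: "res B (\<lambda>j. t * u j) i = t * res B u i"
  by (simp add: res_def sum_distrib_left algebra_simps)

lemma form_sym: "form \<mu> B u v = form \<mu> B v u"
  by (simp add: form_def gram_def wprod_def mult.commute mult.left_commute)

lemma form_add: "form \<mu> B u (\<lambda>j. x j + y j) = form \<mu> B u x + form \<mu> B u y"
  by (simp add: form_def gram_def wprod_def res_add algebra_simps sum.distrib)

lemma form_scale: "form \<mu> B u (\<lambda>j. t * x j) = t * form \<mu> B u x"
  by (simp add: form_def gram_def wprod_def res_scale algebra_simps sum_distrib_left)

lemma form_add_left: "form \<mu> B (\<lambda>j. x j + y j) u = form \<mu> B x u + form \<mu> B y u"
  by (simp add: form_def gram_def wprod_def res_add algebra_simps sum.distrib)

lemma form_scale_left: "form \<mu> B (\<lambda>j. t * x j) u = t * form \<mu> B x u"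
  by (simp add: form_def gram_def wprod_def res_scale algebra_simps sum_distrib_left)

lemma form_add_scale:
  "form \<mu> B (\<lambda>j. z j + t * h j) (\<lambda>j. z j + t * h j) =
   form \<mu> B z z + 2 * t * form \<mu> B h z + t\<^sup>2 * form \<mu> B h h"
  using form_sym[of \<mu> B z h]
  by (simp add: form_add form_scale form_add_left form_scale_left power2_eq_square algebra_simps)

lemma wprod_pos:
  assumes "z n = -1"
  shows "wprod z z > 0"
proof -
  have "w n * z n * z n \<le> wprod z z"
    unfolding wprod_def
    by (rule member_le_sum) (auto simp: mult.assoc w_nonneg)
  then show ?thesis
    using assms w_last by simp
qed

lemma rayleigh_cong: "(\<And>j. j \<le> n \<Longrightarrow> z j = y j) \<Longrightarrow> rayleigh B z = rayleigh B y"
  by (simp add: rayleigh_def gram_def wprod_def res_def)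

lemma form_rayleigh_self:
  assumes "z n = -1"
  shows "form (rayleigh B z) B z z = 0"
  using wprod_pos[of z] assms by (simp add: form_def rayleigh_def)

lemma rayleigh_le_iff:
  assumes "y n = -1"
  shows "\<mu> \<le> rayleigh B y \<longleftrightarrow> 0 \<le> form \<mu> B y y"
  using wprod_pos[of y] assms by (simp add: form_def rayleigh_def field_simps)

lemma form_antimono:
  assumes "\<mu> \<le> \<nu>"
  shows "form \<nu> B h h \<le> form \<mu> B h h"
proof -
  have "0 \<le> wprod h h"
    unfolding wprod_def by (intro sum_nonneg) (auto simp: mult.assoc w_nonneg)
  then show ?thesis
    using assms by (simp add: form_def mult_right_mono)
qed

lemma pos_def_antimono: "\<mu> \<le> \<nu> \<Longrightarrow> pos_def \<nu> B \<Longrightarrow> pos_def \<mu> B"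
  unfolding pos_def_def by (meson form_antimono order_trans)

text \<open>
  The form with \<open>\<mu>\<close> the minimum of the quotient is nonnegative wherever the last entry is \<open>-1\<close> and vanishes at \<open>z\<close>.
  So its first variation vanishes in all directions that keep the last entry; as it also vanishes in
  direction \<open>z\<close>, it vanishes in all directions, that is, \<open>z\<close> is in the kernel.
\<close>

lemma minimizer_stationary:
  assumes "minimizer B z"
  shows "form (rayleigh B z) B h z = 0"
proof -
  define \<mu> where "\<mu> = rayleigh B z"
  have z: "z n = -1" and min: "\<And>y. y n = -1 \<Longrightarrow> 0 \<le> form \<mu> B y y"
    using assms by (auto simp: minimizer_def \<mu>_def rayleigh_le_iff)
  have zz: "form \<mu> B z z = 0"
    using form_rayleigh_self[of z B] z by (simp add: \<mu>_def)
  have *: "form \<mu> B k z = 0" if "k n = 0" for k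
  proof (rule linear_coeff_zero_if_nonneg)
    fix t
    show "0 \<le> 2 * t * form \<mu> B k z + t\<^sup>2 * form \<mu> B k k"
      using min[of "\<lambda>j. z j + t * k j"] that z by (simp add: form_add_scale zz)
  qed
  have "form \<mu> B (\<lambda>j. h j + h n * z j) z = 0"
    by (rule *) (simp add: z)
  then show ?thesis
    by (simp add: form_add_left form_scale_left zz flip: \<mu>_def)
qed

text \<open>
  Because \<open>z\<close> is in the kernel of the form, the value at \<open>z + h\<close> is the value at \<open>h\<close>, which is positive
  unless \<open>h\<close> is zero.
\<close>

lemma minimizer_unique:
  assumes z: "minimizer B z" and pd: "pos_def (rayleigh B z) B" and y: "minimizer B y" and j: "j \<le> n"
  shows "y j = z j"
proof -
  define \<mu> where "\<mu> = rayleigh B z"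
  define h where "h i = y i - z i" for i
  have last: "z n = -1" "y n = -1" and eq: "rayleigh B y = \<mu>"
    using z y by (auto simp: minimizer_def \<mu>_def intro: antisym)
  have "form \<mu> B y y = form \<mu> B (\<lambda>j. z j + 1 * h j) (\<lambda>j. z j + 1 * h j)"
    by (simp add: h_def)
  also have "\<dots> = form \<mu> B h h"
    unfolding form_add_scale using minimizer_stationary[OF z] form_rayleigh_self[of z B] last
    by (simp add: \<mu>_def)
  finally have "form \<mu> B h h = 0"
    using form_rayleigh_self[of y B] last eq by simp
  moreover obtain c where c: "c > 0" "\<And>h. h n = 0 \<Longrightarrow> c * (\<Sum>j\<le>n. (h j)\<^sup>2) \<le> form \<mu> B h h"
    using pd by (auto simp: pos_def_def \<mu>_def)
  ultimately have "c * (\<Sum>j\<le>n. (h j)\<^sup>2) \<le> 0"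
    using c(2)[of h] last by (simp add: h_def)
  then have "(\<Sum>j\<le>n. (h j)\<^sup>2) = 0"
    using c(1) by (meson antisym mult_le_0_iff not_le sum_nonneg zero_le_power2)
  then show ?thesis
    using j by (simp add: sum_nonneg_eq_0_iff h_def)
qed

definition entry :: "real \<Rightarrow> (nat \<Rightarrow> nat \<Rightarrow> real) \<Rightarrow> nat \<Rightarrow> nat \<Rightarrow> real" where
  "entry \<mu> B k l = (\<Sum>i<m. B i k * B i l) - (if k = l then \<mu> * w k else 0)"

lemma form_eq_entry: "form \<mu> B u v = (\<Sum>k\<le>n. \<Sum>l\<le>n. u k * entry \<mu> B k l * v l)"
proof -
  have "gram B u v = (\<Sum>i<m. \<Sum>k\<le>n. \<Sum>l\<le>n. u k * (B i k * B i l) * v l)"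
    unfolding gram_def res_def sum_product by (intro sum.cong refl) (simp add: algebra_simps)
  also have "\<dots> = (\<Sum>k\<le>n. \<Sum>l\<le>n. \<Sum>i<m. u k * (B i k * B i l) * v l)"
    by (subst sum.swap) (intro sum.cong refl sum.swap)
  also have "\<dots> = (\<Sum>k\<le>n. \<Sum>l\<le>n. u k * (\<Sum>i<m. B i k * B i l) * v l)"
    by (simp add: sum_distrib_left sum_distrib_right)
  moreover have "\<mu> * wprod u v = (\<Sum>k\<le>n. \<Sum>l\<le>n. u k * (if k = l then \<mu> * w k else 0) * v l)"
  proof -
    have "(\<Sum>l\<le>n. u k * (if k = l then \<mu> * w k else 0) * v l)
        = (\<Sum>l\<le>n. if l = k then \<mu> * (w k * u k * v k) else 0)" for k
      by (intro sum.cong) auto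
    then show ?thesis
      by (simp add: wprod_def sum_distrib_left)
  qed
  ultimately show ?thesis
    by (simp add: form_def entry_def algebra_simps sum_subtractf)
qed

text \<open>
  Compactness of the unit sphere turns pointwise positivity into the uniform constant.
\<close>

lemma pos_defI:
  assumes pos: "\<And>h. h n = 0 \<Longrightarrow> \<exists>j<n. h j \<noteq> 0 \<Longrightarrow> 0 < form \<mu> B h h"
  shows "pos_def \<mu> B"
proof (cases "n = 0")
  case True
  then have "form \<mu> B h h = 0" if "h n = 0" for h
    unfolding form_eq_entry using True that by simp
  then show ?thesis
    unfolding pos_def_def using True by (intro exI[of _ 1]) simp
next
  case False
  define f where "f h = (\<Sum>k<n. \<Sum>l<n. h k * entry \<mu> B k l * h l)" for h
  have form_f: "form \<mu> B h h = f h" if "h n = 0" for h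
    using that by (simp add: form_eq_entry f_def lessThan_Suc_atMost[symmetric])
  obtain e where e: "(\<Sum>j<n. (e j)\<^sup>2) = 1" and min: "\<And>h. f e * (\<Sum>j<n. (h j)\<^sup>2) \<le> f h"
  proof (rule quadratic_attains_min_on_sphere[of n f])
    show "continuous_on UNIV f"
      unfolding f_def by (intro continuous_intros)
    show "f (\<lambda>j. t * h j) = t\<^sup>2 * f h" for t h
      by (simp add: f_def sum_distrib_left power2_eq_square mult_ac)
  qed (use False in \<open>auto simp: f_def\<close>)
  have "\<exists>j<n. e j \<noteq> 0"
  proof (rule ccontr)
    assume "\<not> (\<exists>j<n. e j \<noteq> 0)"
    then have "(\<Sum>j<n. (e j)\<^sup>2) = 0"
      by simp
    with e show False
      by simp
  qed
  then have "0 < form \<mu> B (e(n := 0)) (e(n := 0))"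
    by (intro pos) auto
  then have "0 < f (e(n := 0))"
    by (simp add: form_f)
  then have "0 < f e"
    by (simp add: f_def)
  moreover have "f e * (\<Sum>j\<le>n. (h j)\<^sup>2) \<le> form \<mu> B h h" if "h n = 0" for h
    using min[of h] form_f[of h] that by (simp add: lessThan_Suc_atMost[symmetric])
  ultimately show ?thesis
    unfolding pos_def_def by blast
qed

lemma form_perturb_bound:
  assumes "\<And>j. j \<le> n \<Longrightarrow> \<bar>u j\<bar> \<le> U" "\<And>j. j \<le> n \<Longrightarrow> \<bar>v j\<bar> \<le> V"
  shows "\<bar>form \<mu>' B' u v - form \<mu> B u v\<bar>
    \<le> (\<Sum>k\<le>n. \<Sum>l\<le>n. \<bar>entry \<mu>' B' k l - entry \<mu> B k l\<bar>) * U * V"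
proof -
  have "form \<mu>' B' u v - form \<mu> B u v
      = (\<Sum>k\<le>n. \<Sum>l\<le>n. u k * (entry \<mu>' B' k l - entry \<mu> B k l) * v l)"
    by (simp add: form_eq_entry right_diff_distrib left_diff_distrib sum_subtractf)
  then have "\<bar>form \<mu>' B' u v - form \<mu> B u v\<bar> \<le> (\<Sum>k\<le>n. \<Sum>l\<le>n. \<bar>u k * (entry \<mu>' B' k l - entry \<mu> B k l) * v l\<bar>)"
    by (simp only:) (rule order_trans[OF sum_abs], intro sum_mono sum_abs)
  also have "\<dots> \<le> (\<Sum>k\<le>n. \<Sum>l\<le>n. \<bar>entry \<mu>' B' k l - entry \<mu> B k l\<bar> * (U * V))"
  proof (intro sum_mono)
    fix k l assume "k \<in> {..n}" "l \<in> {..n}"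
    then have "\<bar>u k\<bar> * \<bar>v l\<bar> \<le> U * V"
      using assms[of k] assms[of l] by (intro mult_mono) auto
    then have "\<bar>entry \<mu>' B' k l - entry \<mu> B k l\<bar> * (\<bar>u k\<bar> * \<bar>v l\<bar>)
        \<le> \<bar>entry \<mu>' B' k l - entry \<mu> B k l\<bar> * (U * V)"
      by (rule mult_left_mono) simp
    then show "\<bar>u k * (entry \<mu>' B' k l - entry \<mu> B k l) * v l\<bar>
        \<le> \<bar>entry \<mu>' B' k l - entry \<mu> B k l\<bar> * (U * V)"
      by (simp add: abs_mult mult.commute mult.left_commute)
  qed
  also have "\<dots> = (\<Sum>k\<le>n. \<Sum>l\<le>n. \<bar>entry \<mu>' B' k l - entry \<mu> B k l\<bar>) * U * V"
    by (simp add: sum_distrib_right mult.assoc)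
  finally show ?thesis .
qed

lemma tendsto_gram:
  assumes "\<And>i j. i < m \<Longrightarrow> j \<le> n \<Longrightarrow> ((\<lambda>d. B' d i j) \<longlongrightarrow> B i j) F"
  shows "((\<lambda>d. gram (B' d) u v) \<longlongrightarrow> gram B u v) F"
  unfolding gram_def res_def using assms by (intro tendsto_intros) auto

lemma tendsto_entry:
  assumes "\<And>i j. i < m \<Longrightarrow> j \<le> n \<Longrightarrow> ((\<lambda>d. B' d i j) \<longlongrightarrow> B i j) F"
    and "(\<mu>' \<longlongrightarrow> \<mu>) F" "k \<le> n" "l \<le> n"
  shows "((\<lambda>d. entry (\<mu>' d) (B' d) k l) \<longlongrightarrow> entry \<mu> B k l) F"
  unfolding entry_def using assms
  by (cases "k = l") (auto intro!: tendsto_intros)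

lemma continuous_on_rayleigh:
  assumes "\<And>y. y \<in> S \<Longrightarrow> y n = -1"
  shows "continuous_on S (rayleigh B)"
proof -
  have "wprod y y \<noteq> 0" if "y \<in> S" for y
    using wprod_pos assms that by fastforce
  then show ?thesis
    unfolding rayleigh_def gram_def res_def wprod_def by (intro continuous_intros) auto
qed

text \<open>
  Take \<open>\<mu>'\<close> to be the perturbed quotient at the old minimizer \<open>z\<close>. The perturbed form with this \<open>\<mu>'\<close> vanishes at \<open>z\<close>,
  has a small multiple of \<open>|h|\<close> as first variation there, and at least \<open>(c/2) |h|\<^sup>2\<close> as its second-order part, so it is
  positive once \<open>|h| \<ge> \<delta>\<close>. Hence all candidates for a minimizer lie in a box around \<open>z\<close>, on which the perturbed
  quotient attains its minimum; that minimum is at most \<open>\<mu>'\<close>, which preserves definiteness.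
\<close>

lemma minimizer_stable:
  assumes lim: "\<And>i j. i < m \<Longrightarrow> j \<le> n \<Longrightarrow> ((\<lambda>d. B' d i j) \<longlongrightarrow> B i j) F"
    and z: "minimizer B z" and pd: "pos_def (rayleigh B z) B" and "\<delta> > 0"
  shows "eventually (\<lambda>d. \<exists>z'. minimizer (B' d) z' \<and> pos_def (rayleigh (B' d) z') (B' d) \<and>
           (\<forall>j\<le>n. \<bar>z' j - z j\<bar> < \<delta>)) F"
proof -
  define \<mu> where "\<mu> = rayleigh B z"
  obtain c where c: "c > 0" "\<And>h. h n = 0 \<Longrightarrow> c * (\<Sum>j\<le>n. (h j)\<^sup>2) \<le> form \<mu> B h h"
    using pd by (auto simp: pos_def_def \<mu>_def)
  define \<mu>' where "\<mu>' d = rayleigh (B' d) z" for d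
  define \<kappa> where "\<kappa> d = (\<Sum>k\<le>n. \<Sum>l\<le>n. \<bar>entry (\<mu>' d) (B' d) k l - entry \<mu> B k l\<bar>)" for d
  define Z where "Z = sqrt (\<Sum>j\<le>n. (z j)\<^sup>2)"
  have last: "z n = -1"
    using z by (simp add: minimizer_def)
  have zZ: "\<bar>z j\<bar> \<le> Z" if "j \<le> n" for j
    using that by (auto simp: Z_def intro!: abs_le_sqrt_sum_squares)
  have "wprod z z \<noteq> 0"
    using wprod_pos[of z] last by simp
  then have \<mu>_lim: "(\<mu>' \<longlongrightarrow> \<mu>) F"
    unfolding \<mu>'_def \<mu>_def rayleigh_def using lim by (intro tendsto_intros tendsto_gram) auto
  have "(\<kappa> \<longlongrightarrow> (\<Sum>k\<le>n. \<Sum>l\<le>n. \<bar>entry \<mu> B k l - entry \<mu> B k l\<bar>)) F"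
    unfolding \<kappa>_def using lim \<mu>_lim by (intro tendsto_intros tendsto_entry) auto
  then have \<kappa>0: "(\<kappa> \<longlongrightarrow> 0) F"
    by simp
  have "((\<lambda>d. 4 * \<kappa> d * Z) \<longlongrightarrow> 4 * 0 * Z) F"
    by (intro tendsto_intros \<kappa>0)
  then have "eventually (\<lambda>d. 4 * \<kappa> d * Z < c * \<delta>) F"
    using c(1) \<open>\<delta> > 0\<close> by (intro order_tendstoD) auto
  moreover have "eventually (\<lambda>d. \<kappa> d < c / 2) F"
    using c(1) by (intro order_tendstoD[OF \<kappa>0]) auto
  ultimately show ?thesis
  proof eventually_elim
    case (elim d)
    \<comment> \<open>half of the definiteness constant absorbs the perturbation of the form\<close>
    have lower: "c / 2 * (\<Sum>j\<le>n. (h j)\<^sup>2) \<le> form (\<mu>' d) (B' d) h h" if "h n = 0" for h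
    proof -
      define s where "s = sqrt (\<Sum>j\<le>n. (h j)\<^sup>2)"
      have hs: "\<bar>h j\<bar> \<le> s" if "j \<le> n" for j
        using that by (auto simp: s_def intro!: abs_le_sqrt_sum_squares)
      have s2: "s * s = (\<Sum>j\<le>n. (h j)\<^sup>2)"
        by (simp add: s_def sum_nonneg)
      have "\<bar>form (\<mu>' d) (B' d) h h - form \<mu> B h h\<bar> \<le> \<kappa> d * s * s"
        unfolding \<kappa>_def by (rule form_perturb_bound) (auto simp: hs)
      moreover have "\<kappa> d * (s * s) \<le> c / 2 * (s * s)"
        using elim by (intro mult_right_mono) auto
      ultimately show ?thesis
        using c(2)[of h] that s2 by (simp add: mult.assoc)
    qed
    \<comment> \<open>far from \<open>z\<close> the perturbed quotient exceeds its value at \<open>z\<close>\<close>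
    have far: "rayleigh (B' d) z < rayleigh (B' d) y"
      if y: "y n = -1" and j: "j \<le> n" "\<delta> \<le> \<bar>y j - z j\<bar>" for y j
    proof -
      define h where "h i = y i - z i" for i
      define s where "s = sqrt (\<Sum>j\<le>n. (h j)\<^sup>2)"
      have hs: "\<bar>h j\<bar> \<le> s" if "j \<le> n" for j
        using that by (auto simp: s_def intro!: abs_le_sqrt_sum_squares)
      have s2: "s * s = (\<Sum>j\<le>n. (h j)\<^sup>2)"
        by (simp add: s_def sum_nonneg)
      have s: "\<delta> \<le> s" "s > 0"
        using hs[OF j(1)] j \<open>\<delta> > 0\<close> by (auto simp: h_def)
      have "\<bar>form (\<mu>' d) (B' d) h z - form \<mu> B h z\<bar> \<le> \<kappa> d * s * Z"
        unfolding \<kappa>_def by (rule form_perturb_bound) (auto simp: hs zZ)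
      then have "- (\<kappa> d * s * Z) \<le> form (\<mu>' d) (B' d) h z"
        using minimizer_stationary[OF z] by (simp add: \<mu>_def)
      moreover have "c / 2 * (s * s) \<le> form (\<mu>' d) (B' d) h h"
        using lower[of h] y last s2 by (simp add: h_def)
      moreover have "4 * \<kappa> d * Z < c * s"
        using elim s c(1) by (meson less_le_trans mult_le_cancel_left_pos)
      then have "s * (4 * \<kappa> d * Z) < s * (c * s)"
        using s by simp
      ultimately have "0 < 2 * form (\<mu>' d) (B' d) h z + form (\<mu>' d) (B' d) h h"
        by (simp add: algebra_simps)
      also have "\<dots> = form (\<mu>' d) (B' d) (\<lambda>j. z j + 1 * h j) (\<lambda>j. z j + 1 * h j)"
        unfolding form_add_scale using form_rayleigh_self[of z] last by (simp add: \<mu>'_def)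
      also have "\<dots> = form (\<mu>' d) (B' d) y y"
        by (simp add: h_def)
      finally show ?thesis
        using wprod_pos[of y] y by (simp add: form_def rayleigh_def[of _ y] \<mu>'_def field_simps)
    qed
    define lo up where "lo j = (if j < n then z j - \<delta> else if j = n then -1 else 0)"
      and "up j = (if j < n then z j + \<delta> else if j = n then -1 else 0)" for j
    define K where "K = {y. \<forall>j. lo j \<le> y j \<and> y j \<le> up j}"
    define z0 where "z0 j = (if j \<le> n then z j else 0)" for j
    have K_last: "y n = -1" if "y \<in> K" for y
      using that by (auto simp: K_def lo_def up_def intro!: antisym dest!: spec[of _ n])
    have "compact K"
      unfolding K_def by (rule compact_coordinate_box)
    moreover have z0: "z0 \<in> K"
      using last \<open>\<delta> > 0\<close> by (auto simp: K_def lo_def up_def z0_def)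
    ultimately obtain z' where z': "z' \<in> K"
      and min: "\<And>y. y \<in> K \<Longrightarrow> rayleigh (B' d) z' \<le> rayleigh (B' d) y"
      using continuous_attains_inf[of K "rayleigh (B' d)"] continuous_on_rayleigh[of K] K_last
      by blast
    have z0_eq: "rayleigh (B' d) z0 = rayleigh (B' d) z"
      by (rule rayleigh_cong) (simp add: z0_def)
    have le: "rayleigh (B' d) z' \<le> \<mu>' d"
      using min[OF z0] z0_eq by (simp add: \<mu>'_def)
    have "rayleigh (B' d) z' \<le> rayleigh (B' d) y" if y: "y n = -1" for y
    proof (cases "\<forall>j\<le>n. \<bar>y j - z j\<bar> \<le> \<delta>")
      case True
      define y0 where "y0 j = (if j \<le> n then y j else 0)" for j
      have "y0 \<in> K"
        using True y last by (auto simp: K_def lo_def up_def y0_def abs_le_iff algebra_simps)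
      moreover have "rayleigh (B' d) y0 = rayleigh (B' d) y"
        by (rule rayleigh_cong) (simp add: y0_def)
      ultimately show ?thesis
        using min by metis
    next
      case False
      then obtain j where "j \<le> n" "\<delta> \<le> \<bar>y j - z j\<bar>"
        by force
      then show ?thesis
        using far[of y j] y le by (simp add: \<mu>'_def)
    qed
    then have "minimizer (B' d) z'"
      using K_last[OF z'] by (simp add: minimizer_def)
    moreover have "pos_def (rayleigh (B' d) z') (B' d)"
    proof (rule pos_def_antimono[OF le])
      show "pos_def (\<mu>' d) (B' d)"
        unfolding pos_def_def using lower c(1) by (intro exI[of _ "c / 2"]) auto
    qed
    moreover have "\<bar>z' j - z j\<bar> < \<delta>" if "j \<le> n" for j
      using far[of z' j] K_last[OF z'] that le by (force simp: \<mu>'_def)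
    ultimately show ?case
      by blast
  qed
qed


section \<open>First-order sensitivity of the minimizer\<close>

text \<open>
  The coefficient of the perturbation of entry \<open>(i, l)\<close> in the identity \<open>minimizer_difference\<close>; \<open>h\<close> will be a row of
  the inverse of \<open>P\<close>.
\<close>

definition sens :: "(nat \<Rightarrow> nat \<Rightarrow> real) \<Rightarrow> (nat \<Rightarrow> real) \<Rightarrow> (nat \<Rightarrow> real) \<Rightarrow> (nat \<Rightarrow> nat \<Rightarrow> real) \<Rightarrow>
    (nat \<Rightarrow> real) \<Rightarrow> nat \<Rightarrow> nat \<Rightarrow> real" where
  "sens B z h B' z' i l =
     (z l * res B' z' i + res B z i * z' l) / wprod z z' * wprod h z' - h l * res B' z' i - res B h i * z' l"

text \<open>
  Both minimizers are in the kernel of their forms. Testing the difference of the two equations with \<open>z\<close>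
  expresses the change of the minimum through the perturbation of \<open>B\<close>, and testing it with \<open>h\<close> then gives the identity.
  Nothing is neglected: all quadratic terms are hidden in the dependence of \<open>sens\<close> on \<open>B'\<close> and \<open>z'\<close>.
\<close>

lemma minimizer_difference:
  assumes z: "minimizer B z" and z': "minimizer B' z'" and nz: "wprod z z' \<noteq> 0"
  shows "form (rayleigh B z) B h (\<lambda>j. z' j - z j)
    = (\<Sum>i<m. \<Sum>l\<le>n. (B' i l - B i l) * sens B z h B' z' i l)"
proof -
  define \<mu> where "\<mu> = rayleigh B z"
  define \<mu>' where "\<mu>' = rayleigh B' z'"
  define E where "E i j = B' i j - B i j" for i j
  define R where "R i = res B' z' i" for i
  define r where "r i = res B z i" for i
  have resE: "res B' u i = res B u i + res E u i" for u i
    by (simp add: res_def E_def left_diff_distrib sum_subtractf)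
  have *: "form \<mu> B g (\<lambda>j. z' j - z j) = (\<mu>' - \<mu>) * wprod g z'
      - (\<Sum>i<m. res E g i * R i + res B g i * res E z' i)" for g
  proof -
    have "form \<mu> B g (\<lambda>j. z' j + (-1) * z j) = form \<mu> B g z' + (-1) * form \<mu> B g z"
      by (simp only: form_add form_scale)
    also have "\<dots> = form \<mu> B g z' - form \<mu>' B' g z'"
      using minimizer_stationary[OF z] minimizer_stationary[OF z'] by (simp add: \<mu>_def \<mu>'_def)
    also have "\<dots> = (\<mu>' - \<mu>) * wprod g z' - (gram B' g z' - gram B g z')"
      by (simp add: form_def algebra_simps)
    also have "gram B' g z' - gram B g z' = (\<Sum>i<m. res E g i * R i + res B g i * res E z' i)"
      by (simp add: gram_def R_def resE algebra_simps flip: sum_subtractf)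
    finally show ?thesis
      by simp
  qed
  have "form \<mu> B z (\<lambda>j. z' j - z j) = 0"
    using minimizer_stationary[OF z] form_sym by (metis \<mu>_def)
  then have "\<mu>' - \<mu> = (\<Sum>i<m. res E z i * R i + r i * res E z' i) / wprod z z'"
    using *[of z] nz by (simp add: r_def field_simps)
  then have "form \<mu> B h (\<lambda>j. z' j - z j) =
      (\<Sum>i<m. (res E z i * R i + r i * res E z' i) / wprod z z' * wprod h z'
         - (res E h i * R i + res B h i * res E z' i))"
    using *[of h] by (simp add: sum_subtractf flip: sum_distrib_right sum_divide_distrib)
  also have "\<dots> = (\<Sum>i<m. \<Sum>l\<le>n. E i l * sens B z h B' z' i l)"
  proof (intro sum.cong refl)
    fix i
    have "(\<Sum>l\<le>n. E i l * sens B z h B' z' i l) =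
       (\<Sum>l\<le>n. (E i l * z l * R i + r i * (E i l * z' l)) / wprod z z' * wprod h z'
         - (E i l * h l * R i + res B h i * (E i l * z' l)))"
      by (intro sum.cong refl) (simp add: sens_def R_def r_def diff_divide_distrib add_divide_distrib algebra_simps)
    also have "\<dots> = (res E z i * R i + r i * res E z' i) / wprod z z' * wprod h z'
         - (res E h i * R i + res B h i * res E z' i)"
      by (simp add: res_def sum_subtractf sum.distrib flip: sum_distrib_right sum_distrib_left sum_divide_distrib)
    finally show "(res E z i * R i + r i * res E z' i) / wprod z z' * wprod h z'
         - (res E h i * R i + res B h i * res E z' i) = (\<Sum>l\<le>n. E i l * sens B z h B' z' i l)"
      by simp
  qed
  finally show ?thesis
    by (simp add: \<mu>_def E_def)
qed

text \<open>
  With \<open>g = res B h\<close> and \<open>r = res B z\<close>, the bracket is entry \<open>i\<close> of \<open>g\<close> reflected by \<open>I - 2 r r\<^sup>T / |r|\<^sup>2\<close>. The reflection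
  appears because stationarity makes \<open>wprod h z / wprod z z\<close> equal to \<open>(g \<bullet> r) / |r|\<^sup>2\<close>.
\<close>

lemma sens_limit:
  assumes z: "minimizer B z" and nz: "gram B z z \<noteq> 0"
  shows "sens B z h B z i l
    = - (res B h i - 2 * res B z i * gram B h z / gram B z z) * z l - h l * res B z i"
proof -
  define \<mu> where "\<mu> = rayleigh B z"
  have "form \<mu> B h z = 0" "form \<mu> B z z = 0"
    using minimizer_stationary[OF z] by (simp_all add: \<mu>_def)
  then have "gram B h z = \<mu> * wprod h z" "gram B z z = \<mu> * wprod z z"
    by (simp_all add: form_def)
  with nz have "wprod h z / wprod z z = gram B h z / gram B z z"
    by simp
  moreover have "sens B z h B z i l
      = 2 * z l * res B z i * (wprod h z / wprod z z) - h l * res B z i - res B h i * z l"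
    by (simp add: sens_def)
  ultimately show ?thesis
    by (simp add: algebra_simps)
qed


text \<open>
  \<open>J\<close> is the inverse of \<open>P\<close>, \<open>G\<close> is \<open>J A\<^sup>T\<close>, and \<open>GH\<close> is \<open>J A\<^sup>T H\<^sub>0\<close>. The bound holds uniformly over
  all perturbations of relative size at most \<open>\<eta>\<close>, with \<open>\<epsilon>\<close> chosen before \<open>\<eta>\<close>; this uniformity is what the suprema in the
  condition numbers require. It is obtained by taking limits along the filter of relative neighbourhoods of \<open>B\<close>.
\<close>

lemma minimizer_sensitivity:
  assumes z: "minimizer B z" and pd: "pos_def (rayleigh B z) B" and nz: "gram B z z \<noteq> 0"
    and J: "\<And>j l. j < n \<Longrightarrow> l < n \<Longrightarrow>
      (\<Sum>k<n. J j k * entry (rayleigh B z) B k l) = (if j = l then 1 else 0)"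
    and G: "\<And>j i. j < n \<Longrightarrow> G j i = (\<Sum>k<n. J j k * B i k)"
    and GH: "\<And>j i. j < n \<Longrightarrow>
      GH j i = G j i - 2 * res B z i * (\<Sum>k<m. G j k * res B z k) / gram B z z"
    and u: "\<And>j. j < n \<Longrightarrow> u j = (\<Sum>i<m. \<bar>GH j i\<bar> * (\<Sum>l\<le>n. \<bar>B i l\<bar> * \<bar>z l\<bar>))
      + (\<Sum>l<n. \<bar>J j l\<bar> * (\<Sum>i<m. \<bar>B i l\<bar> * \<bar>res B z i\<bar>))"
    and "\<delta> > 0"
  shows "\<exists>\<epsilon>>0. \<forall>B' \<eta>. 0 \<le> \<eta> \<longrightarrow> \<eta> \<le> \<epsilon> \<longrightarrow> (\<forall>i<m. \<forall>l\<le>n. \<bar>B' i l - B i l\<bar> \<le> \<eta> * \<bar>B i l\<bar>) \<longrightarrow>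
    (\<exists>z'. minimizer B' z' \<and> (\<forall>y. minimizer B' y \<longrightarrow> (\<forall>j\<le>n. y j = z' j)) \<and>
         (\<forall>j<n. \<bar>z' j - z j\<bar> \<le> \<eta> * (u j + \<delta>)))"
proof -
  define near where "near \<epsilon> = {B'. \<forall>i<m. \<forall>l\<le>n. \<bar>B' i l - B i l\<bar> \<le> \<epsilon> * \<bar>B i l\<bar>}" for \<epsilon>
  have near_mono: "near a \<subseteq> near b" if "a \<le> b" for a b
    unfolding near_def using mult_right_mono[OF that abs_ge_zero] by (blast intro: order_trans)
  define F where "F = (INF \<epsilon>\<in>{0<..}. principal (near \<epsilon>))"
  have F: "eventually P F \<longleftrightarrow> (\<exists>\<epsilon>>0. \<forall>B'\<in>near \<epsilon>. P B')" for P
    unfolding F_def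
  proof (subst eventually_INF_base)
    fix a b :: real assume "a \<in> {0<..}" "b \<in> {0<..}"
    then show "\<exists>x\<in>{0<..}. principal (near x) \<le> inf (principal (near a)) (principal (near b))"
      using near_mono[of "min a b" a] near_mono[of "min a b" b] by (intro bexI[of _ "min a b"]) auto
  qed (auto simp: eventually_principal intro: exI[of _ "1::real"])
  have lim: "((\<lambda>B'. B' i j) \<longlongrightarrow> B i j) F" if "i < m" "j \<le> n" for i j
  proof (rule tendstoI)
    fix e :: real assume "e > 0"
    have "e / (\<bar>B i j\<bar> + 1) * \<bar>B i j\<bar> < e"
      using \<open>e > 0\<close> by (simp add: field_simps)
    moreover have "e / (\<bar>B i j\<bar> + 1) > 0"
      using \<open>e > 0\<close> by (simp add: add_nonneg_pos)
    ultimately show "eventually (\<lambda>B'. dist (B' i j) (B i j) < e) F"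
      unfolding F dist_real_def near_def using that by (force intro: le_less_trans)
  qed
  have last: "z n = -1"
    using z by (simp add: minimizer_def)
  define sel where "sel B' = (SOME y. minimizer B' y)" for B'
  have stable: "eventually (\<lambda>B'. minimizer B' (sel B') \<and> (\<forall>y. minimizer B' y \<longrightarrow> (\<forall>j\<le>n. y j = sel B' j)) \<and>
           (\<forall>j\<le>n. \<bar>sel B' j - z j\<bar> < e)) F" if "e > 0" for e
  proof -
    have "eventually (\<lambda>d. \<exists>z'. minimizer d z' \<and> pos_def (rayleigh d z') d \<and>
           (\<forall>j\<le>n. \<bar>z' j - z j\<bar> < e)) F"
      by (rule minimizer_stable[OF _ z pd that]) (rule lim)
    then show ?thesis
    proof eventually_elim
      case (elim B')
      then obtain y where y: "minimizer B' y" "pos_def (rayleigh B' y) B'" "\<And>j. j \<le> n \<Longrightarrow> \<bar>y j - z j\<bar> < e"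
        by blast
      from y(1) have s: "minimizer B' (sel B')"
        unfolding sel_def by (rule someI[of "minimizer B'"])
      have "v j = sel B' j" if "minimizer B' v" "j \<le> n" for v j
        using minimizer_unique[OF y(1,2) s that(2)] minimizer_unique[OF y(1,2) that] by simp
      moreover have "\<bar>sel B' j - z j\<bar> < e" if "j \<le> n" for j
        using y(3)[OF that] minimizer_unique[OF y(1,2) s that] by simp
      ultimately show ?case
        using s by blast
    qed
  qed
  have sel_lim: "((\<lambda>B'. sel B' j) \<longlongrightarrow> z j) F" if "j \<le> n" for j
  proof (rule tendstoI)
    fix e :: real assume "e > 0"
    from stable[OF this] show "eventually (\<lambda>B'. dist (sel B' j) (z j) < e) F"
      by eventually_elim (use that in \<open>simp add: dist_real_def\<close>)
  qed
  have res_lim: "((\<lambda>B'. res B' (sel B') i) \<longlongrightarrow> res B z i) F" if "i < m" for i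
    unfolding res_def using that by (intro tendsto_intros lim sel_lim) auto
  have wprod_lim: "((\<lambda>B'. wprod v (sel B')) \<longlongrightarrow> wprod v z) F" for v
    unfolding wprod_def by (intro tendsto_intros sel_lim) auto
  have wz: "wprod z z \<noteq> 0"
    using wprod_pos[of z] last by simp
  have sens_lim: "((\<lambda>B'. sens B z h B' (sel B') i l) \<longlongrightarrow> sens B z h B z i l) F" if "i < m" "l \<le> n" for h i l
    unfolding sens_def using that wz by (intro tendsto_intros res_lim wprod_lim sel_lim) auto
  \<comment> \<open>testing with row \<open>j\<close> of \<open>J\<close>, extended by \<open>0\<close>, isolates entry \<open>j\<close> of the difference\<close>
  define row where "row j k = (if k < n then J j k else 0)" for j k
  define bound where "bound j B' = (\<Sum>i<m. \<Sum>l\<le>n. \<bar>B i l\<bar> * \<bar>sens B z (row j) B' (sel B') i l\<bar>)" for j B'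
  have bound_lim: "(bound j \<longlongrightarrow> (\<Sum>i<m. \<Sum>l\<le>n. \<bar>B i l\<bar> * \<bar>sens B z (row j) B z i l\<bar>)) F" for j
    unfolding bound_def by (intro tendsto_intros sens_lim) auto
  have bound_le: "(\<Sum>i<m. \<Sum>l\<le>n. \<bar>B i l\<bar> * \<bar>sens B z (row j) B z i l\<bar>) \<le> u j" if j: "j < n" for j
  proof -
    have res_row: "res B (row j) i = G j i" for i
    proof -
      have "res B (row j) i = (\<Sum>k<n. B i k * row j k) + B i n * row j n"
        by (simp add: res_def lessThan_Suc_atMost[symmetric])
      also have "\<dots> = G j i"
        using G[OF j] by (simp add: row_def mult.commute)
      finally show ?thesis .
    qed
    have "\<bar>sens B z (row j) B z i l\<bar> \<le> \<bar>GH j i\<bar> * \<bar>z l\<bar> + \<bar>row j l\<bar> * \<bar>res B z i\<bar>" for i l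
    proof -
      have "sens B z (row j) B z i l = - (GH j i * z l) - row j l * res B z i"
        unfolding sens_limit[OF z nz] by (simp add: GH[OF j] res_row gram_def left_diff_distrib)
      then show ?thesis
        by (metis abs_minus_cancel abs_mult abs_triangle_ineq4)
    qed
    then have "(\<Sum>i<m. \<Sum>l\<le>n. \<bar>B i l\<bar> * \<bar>sens B z (row j) B z i l\<bar>)
        \<le> (\<Sum>i<m. \<Sum>l\<le>n. \<bar>B i l\<bar> * (\<bar>GH j i\<bar> * \<bar>z l\<bar> + \<bar>row j l\<bar> * \<bar>res B z i\<bar>))"
      by (intro sum_mono mult_left_mono) auto
    also have "\<dots> = (\<Sum>i<m. \<bar>GH j i\<bar> * (\<Sum>l\<le>n. \<bar>B i l\<bar> * \<bar>z l\<bar>))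
        + (\<Sum>i<m. \<Sum>l\<le>n. \<bar>row j l\<bar> * (\<bar>B i l\<bar> * \<bar>res B z i\<bar>))"
      by (simp add: distrib_left sum.distrib sum_distrib_left mult.left_commute)
    also have "(\<Sum>i<m. \<Sum>l\<le>n. \<bar>row j l\<bar> * (\<bar>B i l\<bar> * \<bar>res B z i\<bar>))
        = (\<Sum>l\<le>n. \<bar>row j l\<bar> * (\<Sum>i<m. \<bar>B i l\<bar> * \<bar>res B z i\<bar>))"
      by (subst sum.swap) (simp add: sum_distrib_left)
    also have "\<dots> = (\<Sum>l<n. \<bar>J j l\<bar> * (\<Sum>i<m. \<bar>B i l\<bar> * \<bar>res B z i\<bar>))"
      by (simp add: row_def lessThan_Suc_atMost[symmetric])
    finally show ?thesis
      by (simp only: u[OF j])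
  qed
  have "eventually (\<lambda>B'. bound j B' < u j + \<delta>) F" if "j < n" for j
    using bound_le[OF that] \<open>\<delta> > 0\<close> by (intro order_tendstoD(2)[OF bound_lim]) simp
  then have "eventually (\<lambda>B'. \<forall>j\<in>{..<n}. bound j B' < u j + \<delta>) F"
    by (intro eventually_ball_finite) auto
  moreover have "eventually (\<lambda>B'. wprod z (sel B') \<noteq> 0) F"
    using wprod_lim wz by (rule tendsto_imp_eventually_ne)
  ultimately have "eventually (\<lambda>B'. minimizer B' (sel B') \<and> (\<forall>y. minimizer B' y \<longrightarrow> (\<forall>j\<le>n. y j = sel B' j)) \<and>
      wprod z (sel B') \<noteq> 0 \<and> (\<forall>j<n. bound j B' \<le> u j + \<delta>)) F"
    using stable[of 1, simplified] by eventually_elim (auto intro: less_imp_le)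
  then obtain \<epsilon> where "\<epsilon> > 0" and \<epsilon>: "\<And>B'. B' \<in> near \<epsilon> \<Longrightarrow>
      minimizer B' (sel B') \<and> (\<forall>y. minimizer B' y \<longrightarrow> (\<forall>j\<le>n. y j = sel B' j)) \<and>
      wprod z (sel B') \<noteq> 0 \<and> (\<forall>j<n. bound j B' \<le> u j + \<delta>)"
    unfolding F by blast
  show ?thesis
  proof (intro exI[of _ \<epsilon>] conjI allI impI \<open>\<epsilon> > 0\<close>)
    fix B' \<eta> assume "0 \<le> \<eta>" "\<eta> \<le> \<epsilon>" and pert: "\<forall>i<m. \<forall>l\<le>n. \<bar>B' i l - B i l\<bar> \<le> \<eta> * \<bar>B i l\<bar>"
    from pert \<open>\<eta> \<le> \<epsilon>\<close> have "B' \<in> near \<epsilon>"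
      using near_mono[of \<eta> \<epsilon>] unfolding near_def by blast
    have sel: "minimizer B' (sel B')" "\<forall>y. minimizer B' y \<longrightarrow> (\<forall>j\<le>n. y j = sel B' j)"
      "wprod z (sel B') \<noteq> 0" "\<And>j. j < n \<Longrightarrow> bound j B' \<le> u j + \<delta>"
      using \<epsilon>[OF \<open>B' \<in> near \<epsilon>\<close>] by blast+
    have "\<bar>sel B' j - z j\<bar> \<le> \<eta> * (u j + \<delta>)" if j: "j < n" for j
    proof -
      define dz where "dz l = sel B' l - z l" for l
      have dz: "dz = (\<lambda>l. sel B' l - z l)"
        by (simp add: dz_def fun_eq_iff)
      have "dz n = 0"
        using sel(1) last by (simp add: dz_def minimizer_def)
      then have "form (rayleigh B z) B (row j) dz
          = (\<Sum>k<n. \<Sum>l<n. J j k * entry (rayleigh B z) B k l * dz l)"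
        by (simp add: form_eq_entry lessThan_Suc_atMost[symmetric] row_def)
      also have "\<dots> = (\<Sum>l<n. (\<Sum>k<n. J j k * entry (rayleigh B z) B k l) * dz l)"
        by (subst sum.swap) (simp add: sum_distrib_right)
      also have "\<dots> = (\<Sum>l<n. if j = l then dz l else 0)"
        using J[OF j] by (intro sum.cong) auto
      also have "\<dots> = dz j"
        using j by simp
      finally have "\<bar>dz j\<bar> = \<bar>\<Sum>i<m. \<Sum>l\<le>n. (B' i l - B i l) * sens B z (row j) B' (sel B') i l\<bar>"
        using minimizer_difference[OF z sel(1,3), of "row j"] by (simp only: dz)
      also have "\<dots> \<le> (\<Sum>i<m. \<Sum>l\<le>n. \<bar>(B' i l - B i l) * sens B z (row j) B' (sel B') i l\<bar>)"
        by (rule order_trans[OF sum_abs], intro sum_mono sum_abs)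
      also have "\<dots> \<le> (\<Sum>i<m. \<Sum>l\<le>n. (\<eta> * \<bar>B i l\<bar>) * \<bar>sens B z (row j) B' (sel B') i l\<bar>)"
        unfolding abs_mult using pert by (intro sum_mono mult_right_mono) auto
      also have "\<dots> = \<eta> * bound j B'"
        by (simp add: bound_def sum_distrib_left mult.assoc)
      finally have *: "\<bar>dz j\<bar> \<le> \<eta> * bound j B'" .
      have "\<eta> * bound j B' \<le> \<eta> * (u j + \<delta>)"
        using sel(4)[OF j] \<open>0 \<le> \<eta>\<close> by (simp add: mult_left_mono)
      then show ?thesis
        using * by (simp add: dz_def)
    qed
    then show "\<exists>z'. minimizer B' z' \<and> (\<forall>y. minimizer B' y \<longrightarrow> (\<forall>j\<le>n. y j = z' j)) \<and>
         (\<forall>j<n. \<bar>z' j - z j\<bar> \<le> \<eta> * (u j + \<delta>))"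
      using sel by blast
  qed
qed

end

section \<open>The smallest eigenvalue of a real symmetric matrix\<close>

lemma size_proots_if_all_roots_real:
  fixes p :: "real poly"
  assumes "p \<noteq> 0" and real: "\<And>z :: complex. poly (map_poly of_real p) z = 0 \<Longrightarrow> Im z = 0"
  shows "size (proots p) = degree p"
  using assms
proof (induction "degree p" arbitrary: p)
  case 0
  then obtain c where "p = [:c:]"
    by (metis degree_eq_zeroE)
  then show ?case
    by simp
next
  case (Suc d)
  have "degree (map_poly complex_of_real p) = Suc d"
    using Suc.hyps(2) by simp
  then have "\<not> constant (poly (map_poly complex_of_real p))"
    by (simp add: constant_degree)
  then obtain z :: complex where z: "poly (map_poly of_real p) z = 0"
    using fundamental_theorem_of_algebra by blast
  then have "z = of_real (Re z)"
    using Suc.prems(2) by (simp add: complex_eq_iff)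
  with z have "poly (map_poly complex_of_real p) (of_real (Re z)) = 0"
    by simp
  then have "poly p (Re z) = 0"
    by (metis of_real_eq_0_iff of_real_hom.poly_map_poly)
  then obtain q where q: "p = [:- Re z, 1:] * q"
    by (auto simp: poly_eq_0_iff_dvd)
  then have "q \<noteq> 0"
    using Suc.prems(1) by auto
  have "degree p = Suc (degree q)"
    unfolding q using \<open>q \<noteq> 0\<close> by (subst degree_mult_eq) auto
  moreover have "Im y = 0" if "poly (map_poly of_real q) y = 0" for y :: complex
  proof (rule Suc.prems(2))
    interpret of_real_poly: map_poly_comm_ring_hom "of_real :: real \<Rightarrow> complex" ..
    show "poly (map_poly of_real p) y = 0"
      unfolding q of_real_poly.hom_mult using that by simp
  qed
  ultimately have "size (proots q) = degree q"
    using Suc.hyps \<open>q \<noteq> 0\<close> by simp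
  then show ?case
    using \<open>degree p = Suc (degree q)\<close> \<open>q \<noteq> 0\<close> unfolding q
    by (subst proots_mult) (auto simp: proots_linear_factor)
qed

lemma length_desc_roots [simp]: "length (desc_roots p) = size (proots p)"
  by (simp add: desc_roots_def) (metis mset_sorted_list_of_multiset size_mset)

lemma set_desc_roots: "p \<noteq> 0 \<Longrightarrow> set (desc_roots p) = {x. poly p x = 0}"
  by (simp add: desc_roots_def) 

lemma last_desc_roots:
  assumes "x \<in> set (desc_roots p)" "\<And>y. y \<in> set (desc_roots p) \<Longrightarrow> x \<le> y"
  shows "desc_roots p ! (size (proots p) - 1) = x"
proof -
  define xs where "xs = sorted_list_of_multiset (proots p)"
  have xs: "sorted xs" "set (desc_roots p) = set xs" "desc_roots p = rev xs" "length xs = size (proots p)"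
    using length_desc_roots[of p] by (simp_all add: xs_def desc_roots_def)
  then have "xs \<noteq> []"
    using assms(1) by auto
  have "xs ! 0 = x"
  proof (rule antisym)
    obtain i where "i < length xs" "x = xs ! i"
      using assms(1) xs by (auto simp: in_set_conv_nth)
    then show "xs ! 0 \<le> x"
      using xs(1) by (simp add: sorted_nth_mono)
    show "x \<le> xs ! 0"
      using assms(2)[of "xs ! 0"] nth_mem[of 0 xs] xs(2) \<open>xs \<noteq> []\<close> by simp
  qed
  then show ?thesis
    using \<open>xs \<noteq> []\<close> by (simp add: xs(3) rev_nth flip: xs(4))
qed

lemma quadratic_form_symmetric:
  fixes g :: "nat \<Rightarrow> nat \<Rightarrow> real"
  assumes "\<And>i j. i < k \<Longrightarrow> j < k \<Longrightarrow> g i j = g j i"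
  shows "(\<Sum>i<k. u i * (\<Sum>j<k. g i j * v j)) = (\<Sum>i<k. v i * (\<Sum>j<k. g i j * u j))"
proof -
  have "(\<Sum>i<k. u i * (\<Sum>j<k. g i j * v j)) = (\<Sum>i<k. \<Sum>j<k. v j * (g j i * u i))"
    using assms by (simp add: sum_distrib_left mult_ac)
  also have "\<dots> = (\<Sum>j<k. \<Sum>i<k. v j * (g j i * u i))"
    by (rule sum.swap)
  finally show ?thesis
    by (simp add: sum_distrib_left)
qed

lemma eigenvalue_eq_sums:
  fixes G :: "'a :: field mat"
  assumes G: "G \<in> carrier_mat k k" and "eigenvalue G z"
  obtains v where "\<And>i. i < k \<Longrightarrow> (\<Sum>j<k. G $$ (i, j) * v j) = z * v i" "\<exists>i<k. v i \<noteq> 0"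
proof -
  obtain v where v: "v \<in> carrier_vec k" "v \<noteq> 0\<^sub>v k" "G *\<^sub>v v = z \<cdot>\<^sub>v v"
    using assms by (auto simp: eigenvalue_def eigenvector_def)
  have "(\<Sum>j<k. G $$ (i, j) * v $ j) = z * v $ i" if "i < k" for i
  proof -
    have "(G *\<^sub>v v) $ i = z * v $ i"
      using v that by simp
    then show ?thesis
      using G v(1) that by (simp add: scalar_prod_def atLeast0LessThan)
  qed
  moreover have "\<exists>i<k. v $ i \<noteq> 0"
    using v by (metis eq_vecI carrier_vecD index_zero_vec)
  ultimately show thesis
    using that by blast
qed

text \<open>
  If \<open>G (p + i q) = z (p + i q)\<close>, the contributions of \<open>Re z\<close> cancel in \<open>q\<^sup>T G p = p\<^sup>T G q\<close>, leaving
  \<open>Im z (|p|\<^sup>2 + |q|\<^sup>2) = 0\<close>.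
\<close>

lemma size_proots_char_poly_symmetric:
  fixes G :: "real mat"
  assumes G: "G \<in> carrier_mat k k" and sym: "G\<^sup>T = G"
  shows "size (proots (char_poly G)) = k"
proof -
  have Im0: "Im z = 0" if z: "poly (map_poly of_real (char_poly G)) z = 0" for z :: complex
  proof -
    define Gc where "Gc = map_mat complex_of_real G"
    have Gc: "Gc \<in> carrier_mat k k"
      using G by (simp add: Gc_def)
    have "eigenvalue Gc z"
      using z Gc by (simp add: eigenvalue_root_char_poly Gc_def of_real_hom.char_poly_hom[OF G])
    then obtain v where v: "\<And>i. i < k \<Longrightarrow> (\<Sum>j<k. Gc $$ (i, j) * v j) = z * v i" "\<exists>i<k. v i \<noteq> 0"
      using eigenvalue_eq_sums[OF Gc] by metis
    define p where "p i = Re (v i)" for i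
    define q where "q i = Im (v i)" for i
    have p: "(\<Sum>j<k. G $$ (i, j) * p j) = Re z * p i - Im z * q i"
      and q: "(\<Sum>j<k. G $$ (i, j) * q j) = Re z * q i + Im z * p i" if "i < k" for i
    proof -
      have "(\<Sum>j<k. complex_of_real (G $$ (i, j)) * v j) = z * v i"
        using v(1)[OF that] G that by (simp add: Gc_def)
      from arg_cong[OF this, of Re] arg_cong[OF this, of Im]
      show "(\<Sum>j<k. G $$ (i, j) * p j) = Re z * p i - Im z * q i"
        "(\<Sum>j<k. G $$ (i, j) * q j) = Re z * q i + Im z * p i"
        by (simp_all add: p_def q_def)
    qed
    have "(\<Sum>i<k. q i * (\<Sum>j<k. G $$ (i, j) * p j)) = (\<Sum>i<k. p i * (\<Sum>j<k. G $$ (i, j) * q j))"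
      using G sym by (intro quadratic_form_symmetric) (metis carrier_matD index_transpose_mat(1))
    moreover have "(\<Sum>i<k. q i * (\<Sum>j<k. G $$ (i, j) * p j))
        = (\<Sum>i<k. q i * (Re z * p i - Im z * q i))"
      by (intro sum.cong refl) (simp add: p)
    moreover have "(\<Sum>i<k. p i * (\<Sum>j<k. G $$ (i, j) * q j))
        = (\<Sum>i<k. p i * (Re z * q i + Im z * p i))"
      by (intro sum.cong refl) (simp add: q)
    ultimately have "Im z * (\<Sum>i<k. (p i)\<^sup>2 + (q i)\<^sup>2) = 0"
      by (simp add: algebra_simps power2_eq_square sum.distrib sum_subtractf sum_distrib_left)
    then have "Im z = 0 \<or> (\<Sum>i<k. (p i)\<^sup>2 + (q i)\<^sup>2) = 0"
      by simp
    moreover have "(\<Sum>i<k. (p i)\<^sup>2 + (q i)\<^sup>2) \<noteq> 0"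
    proof -
      obtain i where i: "i < k" "v i \<noteq> 0"
        using v(2) by blast
      then have "0 < (p i)\<^sup>2 + (q i)\<^sup>2"
        by (simp add: p_def q_def complex_eq_iff sum_power2_gt_zero_iff)
      then have "0 < (\<Sum>i<k. (p i)\<^sup>2 + (q i)\<^sup>2)"
        using i by (intro sum_pos2[of _ i]) auto
      then show ?thesis
        by simp
    qed
    ultimately show ?thesis
      by blast
  qed
  have d: "degree (char_poly G) = k" "char_poly G \<noteq> 0"
    using degree_monic_char_poly[OF G] by auto
  show ?thesis
    using size_proots_if_all_roots_real[OF d(2) Im0] d(1) by simp
qed

text \<open>
  A minimizer of the quadratic form on the unit sphere is an eigenvector, and its eigenvalue is at most every other
  one. The index \<open>k - 1\<close> denotes the last entry of the descending list of roots because that list has full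
  length \<open>k\<close>.
\<close>

lemma last_root_char_poly_symmetric:
  fixes G :: "real mat"
  assumes G: "G \<in> carrier_mat k k" and sym: "G\<^sup>T = G" and "0 < k"
  defines "\<nu> \<equiv> desc_roots (char_poly G) ! (k - 1)"
  shows "\<And>h. \<nu> * (\<Sum>i<k. (h i)\<^sup>2) \<le> (\<Sum>i<k. h i * (\<Sum>j<k. G $$ (i, j) * h j))"
    and "\<exists>e. (\<Sum>i<k. (e i)\<^sup>2) = 1 \<and> (\<forall>i<k. (\<Sum>j<k. G $$ (i, j) * e j) = \<nu> * e i)"
proof -
  define f where "f h = (\<Sum>i<k. h i * (\<Sum>j<k. G $$ (i, j) * h j))" for h
  have gsym: "G $$ (i, j) = G $$ (j, i)" if "i < k" "j < k" for i j
    using that G sym by (metis carrier_matD index_transpose_mat(1))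
  obtain e where one: "(\<Sum>i<k. (e i)\<^sup>2) = 1" and min: "\<And>h. f e * (\<Sum>i<k. (h i)\<^sup>2) \<le> f h"
  proof (rule quadratic_attains_min_on_sphere[of k f])
    show "continuous_on UNIV f"
      unfolding f_def by (intro continuous_intros)
    show "f (\<lambda>j. t * h j) = t\<^sup>2 * f h" for t h
      by (simp add: f_def sum_distrib_left power2_eq_square mult_ac)
  qed (use \<open>0 < k\<close> in \<open>auto simp: f_def\<close>)
  have eig: "(\<Sum>j<k. G $$ (i, j) * e j) = f e * e i" if i: "i < k" for i
  proof -
    define h :: "nat \<Rightarrow> real" where "h j = (if j = i then 1 else 0)" for j
    have h: "(\<Sum>j<k. h j * a j) = a i" for a
      using i by (simp add: h_def if_distrib[of "\<lambda>x. x * _"] cong: if_cong)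
    have swap: "(\<Sum>i<k. e i * (\<Sum>j<k. G $$ (i, j) * h j)) = (\<Sum>j<k. G $$ (i, j) * e j)"
      using quadratic_form_symmetric[of k "\<lambda>i j. G $$ (i, j)" e h] gsym by (simp add: h)
    have "(\<Sum>j<k. G $$ (i, j) * e j) - f e * e i = 0"
    proof (rule linear_coeff_zero_if_nonneg)
      fix t
      have "f (\<lambda>j. e j + t * h j) = f e + 2 * t * (\<Sum>j<k. G $$ (i, j) * e j) + t\<^sup>2 * f h"
      proof -
        have "f (\<lambda>j. e j + t * h j) = f e + t * (\<Sum>i<k. h i * (\<Sum>j<k. G $$ (i, j) * e j))
           + t * (\<Sum>i<k. e i * (\<Sum>j<k. G $$ (i, j) * h j)) + t * t * f h"
          by (simp add: f_def algebra_simps sum.distrib sum_distrib_left)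
        then show ?thesis
          by (simp add: swap h power2_eq_square)
      qed
      moreover have "(\<Sum>j<k. (e j + t * h j)\<^sup>2) = 1 + 2 * t * e i + t\<^sup>2 * (\<Sum>j<k. (h j)\<^sup>2)"
      proof -
        have "(\<Sum>j<k. (e j + t * h j)\<^sup>2)
            = (\<Sum>j<k. (e j)\<^sup>2) + 2 * t * (\<Sum>j<k. h j * e j) + t\<^sup>2 * (\<Sum>j<k. (h j)\<^sup>2)"
          by (simp add: power2_eq_square algebra_simps sum.distrib sum_distrib_left)
        then show ?thesis
          by (simp add: one h)
      qed
      ultimately show "0 \<le> 2 * t * ((\<Sum>j<k. G $$ (i, j) * e j) - f e * e i)
          + t\<^sup>2 * (f h - f e * (\<Sum>j<k. (h j)\<^sup>2))"
        using min[of "\<lambda>j. e j + t * h j"] by (simp add: algebra_simps)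
    qed
    then show ?thesis
      by simp
  qed
  have nz: "char_poly G \<noteq> 0"
    using degree_monic_char_poly[OF G] by auto
  have "eigenvalue G (f e)"
  proof -
    have "vec k e \<noteq> 0\<^sub>v k"
    proof
      assume "vec k e = 0\<^sub>v k"
      then have "e i = 0" if "i < k" for i
        using that by (metis index_vec index_zero_vec(1))
      then show False
        using one by simp
    qed
    moreover have "G *\<^sub>v vec k e = f e \<cdot>\<^sub>v vec k e"
      using G eig by (intro eq_vecI) (auto simp: scalar_prod_def atLeast0LessThan)
    ultimately show ?thesis
      using G unfolding eigenvalue_def eigenvector_def by (intro exI[of _ "vec k e"]) auto
  qed
  then have root: "f e \<in> set (desc_roots (char_poly G))"
    using G nz by (simp add: set_desc_roots eigenvalue_root_char_poly)
  have least: "f e \<le> y" if y: "y \<in> set (desc_roots (char_poly G))" for y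
  proof -
    have "eigenvalue G y"
      using y G nz by (simp add: set_desc_roots eigenvalue_root_char_poly)
    then obtain v where v: "\<And>i. i < k \<Longrightarrow> (\<Sum>j<k. G $$ (i, j) * v j) = y * v i" "\<exists>i<k. v i \<noteq> 0"
      using eigenvalue_eq_sums[OF G] by metis
    have "f v = y * (\<Sum>i<k. (v i)\<^sup>2)"
    proof -
      have "f v = (\<Sum>i<k. v i * (y * v i))"
        unfolding f_def by (intro sum.cong refl) (simp add: v(1))
      then show ?thesis
        by (simp add: sum_distrib_left power2_eq_square mult_ac)
    qed
    moreover have "(\<Sum>i<k. (v i)\<^sup>2) > 0"
      using v(2) by (auto intro!: sum_pos2)
    ultimately show ?thesis
      using min[of v] by simp
  qed
  have "\<nu> = f e"
    using last_desc_roots[OF root least] size_proots_char_poly_symmetric[OF G sym] by (simp add: \<nu>_def)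
  then show "\<nu> * (\<Sum>i<k. (h i)\<^sup>2) \<le> (\<Sum>i<k. h i * (\<Sum>j<k. G $$ (i, j) * h j))" for h
    using min by (simp add: f_def)
  show "\<exists>e. (\<Sum>i<k. (e i)\<^sup>2) = 1 \<and> (\<forall>i<k. (\<Sum>j<k. G $$ (i, j) * e j) = \<nu> * e i)"
    using one eig \<open>\<nu> = f e\<close> by blast
qed

section \<open>MTLS solutions as minimizers of the Rayleigh quotient\<close>

lemma append_cols_carrier [simp, intro]:
  "M \<in> carrier_mat m p \<Longrightarrow> N \<in> carrier_mat m q \<Longrightarrow> M @\<^sub>c N \<in> carrier_mat m (p + q)"
  by (intro carrier_matI) (simp_all add: append_cols_def)

lemma append_cols_index:
  assumes "M \<in> carrier_mat m p" "N \<in> carrier_mat m q" "i < m" "j < p + q"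
  shows "(M @\<^sub>c N) $$ (i, j) = (if j < p then M $$ (i, j) else N $$ (i, j - p))"
  using assms by (auto simp: append_cols_def mat_of_cols_index nth_append)

lemma append_cols_assoc:
  assumes "L \<in> carrier_mat m p" "M \<in> carrier_mat m q" "N \<in> carrier_mat m s"
  shows "(L @\<^sub>c M) @\<^sub>c N = L @\<^sub>c M @\<^sub>c N"
proof -
  have LM: "L @\<^sub>c M \<in> carrier_mat m (p + q)" and MN: "M @\<^sub>c N \<in> carrier_mat m (q + s)"
    using assms by auto
  have c: "(L @\<^sub>c M) @\<^sub>c N \<in> carrier_mat m (p + q + s)" "L @\<^sub>c M @\<^sub>c N \<in> carrier_mat m (p + (q + s))"
    using append_cols_carrier[OF LM assms(3)] append_cols_carrier[OF assms(1) MN] by simp_all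
  show ?thesis
  proof (rule eq_matI)
    fix i j assume "i < dim_row (L @\<^sub>c M @\<^sub>c N)" "j < dim_col (L @\<^sub>c M @\<^sub>c N)"
    then have "i < m" "j < p + q + s"
      using c by auto
    then show "((L @\<^sub>c M) @\<^sub>c N) $$ (i, j) = (L @\<^sub>c M @\<^sub>c N) $$ (i, j)"
      by (auto simp: append_cols_index[OF LM assms(3)] append_cols_index[OF assms(1) MN]
          append_cols_index[OF assms(1,2)] append_cols_index[OF assms(2,3)])
  qed (use c in auto)
qed

lemma col_mat_carrier [simp, intro]: "v \<in> carrier_vec m \<Longrightarrow> col_mat v \<in> carrier_mat m 1"
  by (intro carrier_matI) (simp_all add: col_mat_def)

lemma col_mat_index: "v \<in> carrier_vec m \<Longrightarrow> i < m \<Longrightarrow> col_mat v $$ (i, 0) = v $ i"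
  by (auto simp: col_mat_def mat_of_cols_index)

lemma append_col_carrier:
  assumes "E \<in> carrier_mat m q" "f \<in> carrier_vec m"
  shows "E @\<^sub>c col_mat f \<in> carrier_mat m (q + 1)"
  by (rule append_cols_carrier[OF assms(1) col_mat_carrier[OF assms(2)]])

lemma append_col_index:
  assumes "E \<in> carrier_mat m q" "f \<in> carrier_vec m" "i < m" "j \<le> q"
  shows "(E @\<^sub>c col_mat f) $$ (i, j) = (if j < q then E $$ (i, j) else f $ i)"
  using append_cols_index[OF assms(1) col_mat_carrier[OF assms(2)] assms(3), of j] assms(2-4)
  by (auto simp: col_mat_index)

lemma stacked_index_less:
  fixes i j p q :: nat
  assumes "i < p" "j < q"
  shows "j * p + i < p * q"
proof -
  have "j * p + i < (j + 1) * p"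
    using assms(1) by simp
  also have "\<dots> \<le> q * p"
    using assms(2) by (intro mult_le_mono1) simp
  finally show ?thesis
    by (simp add: mult.commute)
qed

lemma inj_vec_of_mat:
  assumes M: "M \<in> carrier_mat p q" "N \<in> carrier_mat p q" and eq: "vec_of_mat M = vec_of_mat N"
  shows "M = N"
proof (rule eq_matI)
  fix i j assume "i < dim_row N" "j < dim_col N"
  then have ij: "i < p" "j < q"
    using M by auto
  then have "j * p + i < p * q"
    by (rule stacked_index_less)
  then have "M $$ ((j * p + i) mod p, (j * p + i) div p) = N $$ ((j * p + i) mod p, (j * p + i) div p)"
    using arg_cong[OF eq, of "\<lambda>v. v $ (j * p + i)"] M by (simp add: vec_of_mat_def)
  then show "M $$ (i, j) = N $$ (i, j)"
    using ij by simp
qed (use M in auto)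

lemma sum_atMost_split:
  fixes g :: "nat \<Rightarrow> real"
  shows "(\<Sum>j\<le>p + q. g j) = (\<Sum>j<p. g j) + (\<Sum>j\<le>q. g (p + j))"
  by (induction q) (auto simp: lessThan_Suc_atMost[symmetric])

lemma sum_lessThan_split:
  fixes g :: "nat \<Rightarrow> real"
  shows "(\<Sum>j<p + q. g j) = (\<Sum>j<p. g j) + (\<Sum>j<q. g (p + j))"
  by (induction q) auto

lemma sum_mult_squared_le:
  fixes f g :: "nat \<Rightarrow> real"
  shows "(\<Sum>i\<in>I. f i * g i)\<^sup>2 \<le> (\<Sum>i\<in>I. (f i)\<^sup>2) * (\<Sum>i\<in>I. (g i)\<^sup>2)"
proof -
  have "\<bar>\<Sum>i\<in>I. f i * g i\<bar> \<le> L2_set f I * L2_set g I"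
    using L2_set_mult_ineq[of f g I] by (intro order_trans[OF sum_abs]) (simp add: abs_mult)
  then have "\<bar>\<Sum>i\<in>I. f i * g i\<bar>\<^sup>2 \<le> (L2_set f I * L2_set g I)\<^sup>2"
    by (intro power_mono) auto
  then show ?thesis
    by (simp add: power_mult_distrib L2_set_def sum_nonneg)
qed

lemma norm_frob_append_col:
  assumes "E \<in> carrier_mat m q" "f \<in> carrier_vec m"
  shows "(norm_frob (E @\<^sub>c col_mat f))\<^sup>2 = (\<Sum>i<m. (\<Sum>j<q. (E $$ (i, j))\<^sup>2) + (f $ i)\<^sup>2)"
proof -
  have C: "E @\<^sub>c col_mat f \<in> carrier_mat m (q + 1)"
    by (rule append_col_carrier[OF assms])
  have "(norm_frob (E @\<^sub>c col_mat f))\<^sup>2 = (\<Sum>i<m. \<Sum>j<q + 1. ((E @\<^sub>c col_mat f) $$ (i, j))\<^sup>2)"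
    using C by (simp add: norm_frob_def sum_nonneg del: sum.lessThan_Suc)
  also have "\<dots> = (\<Sum>i<m. (\<Sum>j<q. (E $$ (i, j))\<^sup>2) + (f $ i)\<^sup>2)"
    using assms by (intro sum.cong refl) (simp add: append_col_index[OF assms])
  finally show ?thesis .
qed

definition tail_weight :: "nat \<Rightarrow> nat \<Rightarrow> real" where
  "tail_weight p j = (if j < p then 0 else 1)"

lemma mtls_W_index:
  assumes "k < n1 + n2" "l < n1 + n2"
  shows "mtls_W n1 n2 $$ (k, l) = (if k = l then tail_weight n1 k else 0)"
  using assms by (auto simp: mtls_W_def Let_def tail_weight_def)

lemma weighted_residual_tail_weight: "p \<le> n \<Longrightarrow> weighted_residual n (tail_weight p)"
  by unfold_locales (auto simp: tail_weight_def)

definition mtls_coeff :: "real mat \<Rightarrow> real mat \<Rightarrow> real vec \<Rightarrow> nat \<Rightarrow> nat \<Rightarrow> real" where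
  "mtls_coeff A1 A2 b i j = (A1 @\<^sub>c A2 @\<^sub>c col_mat b) $$ (i, j)"

definition homogenize :: "real vec \<Rightarrow> nat \<Rightarrow> real" where
  "homogenize x j = (if j < dim_vec x then x $ j else -1)"

locale mtls_data =
  fixes m n1 n2 :: nat and A1 A2 :: "real mat" and b :: "real vec"
  assumes A1: "A1 \<in> carrier_mat m n1" and A2: "A2 \<in> carrier_mat m n2" and b: "b \<in> carrier_vec m"
begin

sublocale weighted_residual m "n1 + n2" "tail_weight n1"
  by (rule weighted_residual_tail_weight) simp

abbreviation "B \<equiv> mtls_coeff A1 A2 b"

lemma coeff:
  assumes "i < m"
  shows "j < n1 \<Longrightarrow> B i j = A1 $$ (i, j)" "j < n2 \<Longrightarrow> B i (n1 + j) = A2 $$ (i, j)" "B i (n1 + n2) = b $ i"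
proof -
  have *: "B i j = (if j < n1 then A1 $$ (i, j) else if j < n1 + n2 then A2 $$ (i, j - n1) else b $ i)"
    if "j \<le> n1 + n2" for j
    using that assms append_col_index[OF A2 b assms, of "j - n1"]
    by (auto simp: mtls_coeff_def append_cols_index[OF A1 append_col_carrier[OF A2 b]])
  show "j < n1 \<Longrightarrow> B i j = A1 $$ (i, j)" "j < n2 \<Longrightarrow> B i (n1 + j) = A2 $$ (i, j)" "B i (n1 + n2) = b $ i"
    by (simp_all add: *)
qed

lemma coeff_left:
  assumes "i < m" "j < n1 + n2"
  shows "B i j = (A1 @\<^sub>c A2) $$ (i, j)"
proof -
  have "A1 @\<^sub>c A2 @\<^sub>c col_mat b = (A1 @\<^sub>c A2) @\<^sub>c col_mat b"
    by (rule append_cols_assoc[OF A1 A2 col_mat_carrier[OF b], symmetric])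
  then show ?thesis
    using assms by (simp add: mtls_coeff_def append_col_index[OF append_cols_carrier[OF A1 A2] b])
qed

lemma res_split: "i < m \<Longrightarrow> res B z i =
    (\<Sum>j<n1. A1 $$ (i, j) * z j) + (\<Sum>j<n2. A2 $$ (i, j) * z (n1 + j)) + b $ i * z (n1 + n2)"
  unfolding res_def sum_atMost_split by (simp add: lessThan_Suc_atMost[symmetric] coeff)

lemma wprod_split: "wprod z z = (\<Sum>j\<le>n2. (z (n1 + j))\<^sup>2)"
  by (simp add: wprod_def sum_atMost_split tail_weight_def power2_eq_square)

text \<open>
  Row \<open>i\<close> of \<open>[E, f]\<close> only has to reproduce the residual at the vector \<open>(x\<^sub>2, -1)\<close>, so the rows decouple.
\<close>

lemma feasible_iff:
  "mtls_feasible A1 A2 b E f x \<longleftrightarrow>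
     E \<in> carrier_mat m n2 \<and> f \<in> carrier_vec m \<and> x \<in> carrier_vec (n1 + n2) \<and>
     (\<forall>i<m. (\<Sum>j<n2. E $$ (i, j) * homogenize x (n1 + j)) - f $ i = - res B (homogenize x) i)"
proof -
  have "A1 *\<^sub>v vec_first x n1 + (A2 + E) *\<^sub>v vec_last x n2 = b + f \<longleftrightarrow>
      (\<forall>i<m. (\<Sum>j<n2. E $$ (i, j) * homogenize x (n1 + j)) - f $ i = - res B (homogenize x) i)"
    if E: "E \<in> carrier_mat m n2" and f: "f \<in> carrier_vec m" and x: "x \<in> carrier_vec (n1 + n2)"
  proof -
    have lhs: "(A1 *\<^sub>v vec_first x n1 + (A2 + E) *\<^sub>v vec_last x n2) $ i
        = (\<Sum>j<n1. A1 $$ (i, j) * x $ j) + (\<Sum>j<n2. A2 $$ (i, j) * x $ (n1 + j))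
          + (\<Sum>j<n2. E $$ (i, j) * x $ (n1 + j))" if "i < m" for i
      using that A1 A2 E x
      by (simp add: scalar_prod_def vec_first_def vec_last_def atLeast0LessThan algebra_simps sum.distrib)
    have "A1 *\<^sub>v vec_first x n1 + (A2 + E) *\<^sub>v vec_last x n2 = b + f \<longleftrightarrow>
       (\<forall>i<m. (A1 *\<^sub>v vec_first x n1 + (A2 + E) *\<^sub>v vec_last x n2) $ i = (b + f) $ i)"
      using A1 A2 b E f by (auto simp: vec_eq_iff)
    also have "\<dots> \<longleftrightarrow> (\<forall>i<m. (\<Sum>j<n2. E $$ (i, j) * homogenize x (n1 + j)) - f $ i = - res B (homogenize x) i)"
      using x b f by (auto simp: lhs res_split homogenize_def)
    finally show ?thesis .
  qed
  then show ?thesis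
    using A1 A2 b unfolding mtls_feasible_def by auto
qed

lemma homogenize_last: "x \<in> carrier_vec (n1 + n2) \<Longrightarrow> homogenize x (n1 + n2) = -1"
  by (simp add: homogenize_def)

text \<open>
  Cauchy-Schwarz in each row of \<open>[E, f]\<close>.
\<close>

lemma rayleigh_le_feasible:
  assumes feas: "mtls_feasible A1 A2 b E f x"
  shows "rayleigh B (homogenize x) \<le> (norm_frob (E @\<^sub>c col_mat f))\<^sup>2"
proof -
  define z where "z = homogenize x"
  have E: "E \<in> carrier_mat m n2" and f: "f \<in> carrier_vec m" and x: "x \<in> carrier_vec (n1 + n2)"
    and eq: "\<And>i. i < m \<Longrightarrow> (\<Sum>j<n2. E $$ (i, j) * z (n1 + j)) - f $ i = - res B z i"
    using feas unfolding feasible_iff z_def by auto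
  have z: "z (n1 + n2) = -1"
    using x by (simp add: z_def homogenize_last)
  define C where "C i j = (if j < n2 then E $$ (i, j) else f $ i)" for i j
  have "(res B z i)\<^sup>2 \<le> ((\<Sum>j<n2. (E $$ (i, j))\<^sup>2) + (f $ i)\<^sup>2) * wprod z z" if i: "i < m" for i
  proof -
    have "(\<Sum>j\<le>n2. C i j * z (n1 + j)) = - res B z i"
      using eq[OF i] z by (simp add: C_def lessThan_Suc_atMost[symmetric])
    moreover have "(\<Sum>j\<le>n2. (C i j)\<^sup>2) = (\<Sum>j<n2. (E $$ (i, j))\<^sup>2) + (f $ i)\<^sup>2"
      by (simp add: C_def lessThan_Suc_atMost[symmetric])
    ultimately show ?thesis
      using sum_mult_squared_le[of "C i" "\<lambda>j. z (n1 + j)" "{..n2}"] by (simp add: wprod_split)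
  qed
  then have "gram B z z \<le> (\<Sum>i<m. ((\<Sum>j<n2. (E $$ (i, j))\<^sup>2) + (f $ i)\<^sup>2) * wprod z z)"
    unfolding gram_def by (intro sum_mono) (simp add: power2_eq_square)
  also have "\<dots> = (norm_frob (E @\<^sub>c col_mat f))\<^sup>2 * wprod z z"
    unfolding norm_frob_append_col[OF E f] by (simp only: sum_distrib_right)
  finally show ?thesis
    using wprod_pos[of z] z by (simp add: rayleigh_def z_def[symmetric] field_simps)
qed

text \<open>
  Equality in Cauchy-Schwarz: the rows of \<open>[E, f]\<close> are multiples of \<open>(x\<^sub>2, -1)\<close>.
\<close>

lemma rayleigh_attained:
  assumes x: "x \<in> carrier_vec (n1 + n2)"
  obtains E f where "mtls_feasible A1 A2 b E f x"
    "(norm_frob (E @\<^sub>c col_mat f))\<^sup>2 = rayleigh B (homogenize x)"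
proof -
  define z where "z = homogenize x"
  define s where "s = wprod z z"
  have z: "z (n1 + n2) = -1"
    using x by (simp add: z_def homogenize_last)
  then have s: "s > 0"
    by (simp add: s_def wprod_pos)
  have s_eq: "s = (\<Sum>j<n2. (z (n1 + j))\<^sup>2) + 1"
    using z by (simp add: s_def wprod_split lessThan_Suc_atMost[symmetric])
  define E where "E = mat m n2 (\<lambda>(i, j). - res B z i * z (n1 + j) / s)"
  define f where "f = vec m (\<lambda>i. res B z i / s)"
  have E: "E \<in> carrier_mat m n2" and f: "f \<in> carrier_vec m"
    by (simp_all add: E_def f_def)
  have "(\<Sum>j<n2. E $$ (i, j) * z (n1 + j)) - f $ i = - res B z i" if "i < m" for i
  proof -
    have "(\<Sum>j<n2. E $$ (i, j) * z (n1 + j)) = (\<Sum>j<n2. - (res B z i / s) * (z (n1 + j))\<^sup>2)"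
      using that by (intro sum.cong) (auto simp: E_def power2_eq_square)
    also have "\<dots> = - (res B z i / s) * (s - 1)"
      unfolding sum_distrib_left[symmetric] by (simp add: s_eq)
    finally show ?thesis
      using s that by (simp add: f_def field_simps)
  qed
  then have "mtls_feasible A1 A2 b E f x"
    unfolding feasible_iff z_def[symmetric] using E f x by simp
  moreover have "(norm_frob (E @\<^sub>c col_mat f))\<^sup>2 = rayleigh B (homogenize x)"
  proof -
    have "(\<Sum>j<n2. (E $$ (i, j))\<^sup>2) + (f $ i)\<^sup>2 = (res B z i)\<^sup>2 / s" if "i < m" for i
    proof -
      have "(\<Sum>j<n2. (E $$ (i, j))\<^sup>2) = (\<Sum>j<n2. (res B z i / s)\<^sup>2 * (z (n1 + j))\<^sup>2)"
        using that by (intro sum.cong) (auto simp: E_def power_mult_distrib power_divide)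
      also have "\<dots> = (res B z i / s)\<^sup>2 * (s - 1)"
        by (simp add: s_eq flip: sum_distrib_left)
      finally have "(\<Sum>j<n2. (E $$ (i, j))\<^sup>2) + (f $ i)\<^sup>2 = (res B z i / s)\<^sup>2 * s"
        using that by (simp add: f_def algebra_simps)
      then show ?thesis
        using s by (simp add: power_divide power2_eq_square)
    qed
    then have "(norm_frob (E @\<^sub>c col_mat f))\<^sup>2 = (\<Sum>i<m. (res B z i)\<^sup>2 / s)"
      unfolding norm_frob_append_col[OF E f] by (intro sum.cong) auto
    then show ?thesis
      by (simp add: rayleigh_def gram_def z_def s_def power2_eq_square sum_divide_distrib)
  qed
  ultimately show thesis
    by (rule that)
qed

lemma norm_frob_nonneg: "0 \<le> norm_frob M"
  by (simp add: norm_frob_def sum_nonneg)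

lemma mtls_solution_iff_minimizer:
  "mtls_solution A1 A2 b x \<longleftrightarrow> x \<in> carrier_vec (n1 + n2) \<and> minimizer B (homogenize x)"
proof
  assume "mtls_solution A1 A2 b x"
  then obtain E f where feas: "mtls_feasible A1 A2 b E f x"
    and min: "\<And>E' f' x'. mtls_feasible A1 A2 b E' f' x' \<Longrightarrow>
        norm_frob (E @\<^sub>c col_mat f) \<le> norm_frob (E' @\<^sub>c col_mat f')"
    unfolding mtls_solution_def by blast
  have x: "x \<in> carrier_vec (n1 + n2)"
    using feas by (simp add: feasible_iff)
  have "rayleigh B (homogenize x) \<le> rayleigh B y" if y: "y (n1 + n2) = -1" for y
  proof -
    define x' where "x' = vec (n1 + n2) y"
    have x': "x' \<in> carrier_vec (n1 + n2)"
      by (simp add: x'_def)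
    obtain E' f' where feas': "mtls_feasible A1 A2 b E' f' x'"
      and norm': "(norm_frob (E' @\<^sub>c col_mat f'))\<^sup>2 = rayleigh B (homogenize x')"
      using rayleigh_attained[OF x'] by blast
    have "rayleigh B (homogenize x) \<le> (norm_frob (E @\<^sub>c col_mat f))\<^sup>2"
      by (rule rayleigh_le_feasible[OF feas])
    also have "\<dots> \<le> (norm_frob (E' @\<^sub>c col_mat f'))\<^sup>2"
      using min[OF feas'] by (intro power_mono norm_frob_nonneg)
    also have "\<dots> = rayleigh B (homogenize x')"
      by (rule norm')
    also have "\<dots> = rayleigh B y"
      using y by (intro rayleigh_cong) (auto simp: homogenize_def x'_def le_less)
    finally show ?thesis .
  qed
  then show "x \<in> carrier_vec (n1 + n2) \<and> minimizer B (homogenize x)"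
    using x by (simp add: minimizer_def homogenize_last)
next
  assume x: "x \<in> carrier_vec (n1 + n2) \<and> minimizer B (homogenize x)"
  then obtain E f where feas: "mtls_feasible A1 A2 b E f x"
    and norm: "(norm_frob (E @\<^sub>c col_mat f))\<^sup>2 = rayleigh B (homogenize x)"
    using rayleigh_attained by blast
  have "norm_frob (E @\<^sub>c col_mat f) \<le> norm_frob (E' @\<^sub>c col_mat f')"
    if feas': "mtls_feasible A1 A2 b E' f' x'" for E' f' x'
  proof -
    have "x' \<in> carrier_vec (n1 + n2)"
      using feas' by (simp add: feasible_iff)
    then have "rayleigh B (homogenize x) \<le> rayleigh B (homogenize x')"
      using x by (simp add: minimizer_def homogenize_last)
    then have "(norm_frob (E @\<^sub>c col_mat f))\<^sup>2 \<le> (norm_frob (E' @\<^sub>c col_mat f'))\<^sup>2"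
      using rayleigh_le_feasible[OF feas'] norm by simp
    then show ?thesis
      by (rule power2_le_imp_le) (rule norm_frob_nonneg)
  qed
  then show "mtls_solution A1 A2 b x"
    using feas unfolding mtls_solution_def by blast
qed

lemma x_mtls_eq:
  assumes z: "minimizer B z" and uniq: "\<And>y j. minimizer B y \<Longrightarrow> j \<le> n1 + n2 \<Longrightarrow> y j = z j"
  shows "x_mtls A1 A2 b = vec (n1 + n2) z"
  unfolding x_mtls_def
proof (rule the_equality)
  have "rayleigh B (homogenize (vec (n1 + n2) z)) = rayleigh B z"
    using z by (intro rayleigh_cong) (auto simp: homogenize_def minimizer_def le_less)
  then show "mtls_solution A1 A2 b (vec (n1 + n2) z)"
    using z unfolding mtls_solution_iff_minimizer by (simp add: minimizer_def homogenize_def)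
next
  fix x assume "mtls_solution A1 A2 b x"
  then have x: "x \<in> carrier_vec (n1 + n2)" "minimizer B (homogenize x)"
    by (simp_all add: mtls_solution_iff_minimizer)
  show "x = vec (n1 + n2) z"
  proof (rule eq_vecI)
    fix i assume "i < dim_vec (vec (n1 + n2) z)"
    then show "x $ i = vec (n1 + n2) z $ i"
      using uniq[OF x(2), of i] x(1) by (simp add: homogenize_def)
  qed (use x in simp)
qed

lemma data_carrier: "A1 @\<^sub>c A2 @\<^sub>c col_mat b \<in> carrier_mat m (n1 + (n2 + 1))"
  by (rule append_cols_carrier[OF A1 append_col_carrier[OF A2 b]])

text \<open>
  The stacked vector determines \<open>A1\<close>, \<open>A2\<close> and \<open>b\<close>, so the existential quantifier in \<open>mtls_map\<close> has a single witness.
\<close>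

lemma mtls_map_eq: "mtls_map m n1 n2 (vec_of_mat (A1 @\<^sub>c A2 @\<^sub>c col_mat b)) = x_mtls A1 A2 b"
proof -
  have "A1' = A1 \<and> A2' = A2 \<and> b' = b"
    if A1': "A1' \<in> carrier_mat m n1" and A2': "A2' \<in> carrier_mat m n2" and b': "b' \<in> carrier_vec m"
      and eq: "vec_of_mat (A1 @\<^sub>c A2 @\<^sub>c col_mat b) = vec_of_mat (A1' @\<^sub>c A2' @\<^sub>c col_mat b')" for A1' A2' b'
  proof -
    interpret d: mtls_data m n1 n2 A1' A2' b'
      by unfold_locales (rule A1' A2' b')+
    have "A1 @\<^sub>c A2 @\<^sub>c col_mat b = A1' @\<^sub>c A2' @\<^sub>c col_mat b'"
      by (rule inj_vec_of_mat[OF data_carrier d.data_carrier eq])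
    then have eq': "mtls_coeff A1 A2 b i j = mtls_coeff A1' A2' b' i j" for i j
      by (simp add: mtls_coeff_def)
    have "A1' = A1" "A2' = A2" "b' = b"
      using A1 A2 b A1' A2' b' coeff d.coeff eq' by (auto intro!: eq_matI eq_vecI)
    then show ?thesis
      by blast
  qed
  then have "(\<exists>A1' A2' b'. A1' \<in> carrier_mat m n1 \<and> A2' \<in> carrier_mat m n2 \<and> b' \<in> carrier_vec m \<and>
        vec_of_mat (A1 @\<^sub>c A2 @\<^sub>c col_mat b) = vec_of_mat (A1' @\<^sub>c A2' @\<^sub>c col_mat b') \<and> mtls_solution A1' A2' b' x)
      \<longleftrightarrow> mtls_solution A1 A2 b x" for x
    using A1 A2 b by blast
  then show ?thesis
    unfolding mtls_map_def x_mtls_def by simp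
qed

end

section \<open>Genericity and the minimum of the quotient\<close>

lemma gram_matrix_form:
  fixes C :: "real mat"
  assumes C: "C \<in> carrier_mat r q"
  shows "(\<Sum>i<q. t i * (\<Sum>j<q. (C\<^sup>T * C) $$ (i, j) * t j)) = (\<Sum>k<r. (\<Sum>j<q. C $$ (k, j) * t j)\<^sup>2)"
proof -
  have entry: "(C\<^sup>T * C) $$ (i, j) = (\<Sum>k<r. C $$ (k, i) * C $$ (k, j))" if "i < q" "j < q" for i j
    using that C by (simp add: scalar_prod_def atLeast0LessThan)
  have "(\<Sum>i<q. t i * (\<Sum>j<q. (C\<^sup>T * C) $$ (i, j) * t j))
      = (\<Sum>i<q. \<Sum>j<q. \<Sum>k<r. C $$ (k, i) * t i * (C $$ (k, j) * t j))"
    by (intro sum.cong refl) (simp add: entry sum_distrib_left sum_distrib_right mult_ac)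
  also have "\<dots> = (\<Sum>i<q. \<Sum>k<r. \<Sum>j<q. C $$ (k, i) * t i * (C $$ (k, j) * t j))"
    by (intro sum.cong refl sum.swap)
  also have "\<dots> = (\<Sum>k<r. \<Sum>i<q. \<Sum>j<q. C $$ (k, i) * t i * (C $$ (k, j) * t j))"
    by (rule sum.swap)
  also have "\<dots> = (\<Sum>k<r. (\<Sum>j<q. C $$ (k, j) * t j)\<^sup>2)"
    by (simp add: power2_eq_square sum_product)
  finally show ?thesis .
qed

text \<open>
  The square of the smallest singular value as the minimum of \<open>|C t|\<^sup>2\<close> over unit vectors.
\<close>

lemma last_root_gram_matrix:
  fixes C :: "real mat"
  assumes C: "C \<in> carrier_mat r q" and "0 < q"
  defines "\<nu> \<equiv> desc_roots (char_poly (C\<^sup>T * C)) ! (q - 1)"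
  shows "\<And>t. \<nu> * (\<Sum>j<q. (t j)\<^sup>2) \<le> (\<Sum>k<r. (\<Sum>j<q. C $$ (k, j) * t j)\<^sup>2)"
    and "\<exists>e. (\<Sum>j<q. (e j)\<^sup>2) = 1 \<and> (\<Sum>k<r. (\<Sum>j<q. C $$ (k, j) * e j)\<^sup>2) = \<nu>"
    and "0 \<le> \<nu>"
proof -
  have G: "C\<^sup>T * C \<in> carrier_mat q q" "(C\<^sup>T * C)\<^sup>T = C\<^sup>T * C"
    using C by (auto simp: transpose_mult[of "C\<^sup>T" q r C q])
  show "\<nu> * (\<Sum>j<q. (t j)\<^sup>2) \<le> (\<Sum>k<r. (\<Sum>j<q. C $$ (k, j) * t j)\<^sup>2)" for t
    using last_root_char_poly_symmetric(1)[OF G \<open>0 < q\<close>, of t] by (simp only: \<nu>_def gram_matrix_form[OF C])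
  obtain e where e: "(\<Sum>i<q. (e i)\<^sup>2) = 1" "\<forall>i<q. (\<Sum>j<q. (C\<^sup>T * C) $$ (i, j) * e j) = \<nu> * e i"
    using last_root_char_poly_symmetric(2)[OF G \<open>0 < q\<close>] by (auto simp: \<nu>_def)
  have "(\<Sum>i<q. e i * (\<Sum>j<q. (C\<^sup>T * C) $$ (i, j) * e j)) = (\<Sum>i<q. e i * (\<nu> * e i))"
    using e(2) by (intro sum.cong) auto
  also have "\<dots> = \<nu> * (\<Sum>i<q. (e i)\<^sup>2)"
    by (simp add: sum_distrib_left power2_eq_square mult_ac)
  finally have val: "(\<Sum>k<r. (\<Sum>j<q. C $$ (k, j) * e j)\<^sup>2) = \<nu>"
    using e(1) by (simp only: gram_matrix_form[OF C])
  then show "\<exists>e. (\<Sum>j<q. (e j)\<^sup>2) = 1 \<and> (\<Sum>k<r. (\<Sum>j<q. C $$ (k, j) * e j)\<^sup>2) = \<nu>"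
    using e(1) by blast
  show "0 \<le> \<nu>"
    unfolding val[symmetric] by (intro sum_nonneg) auto
qed

lemma full_column_rank_imp_injective:
  fixes A :: "real mat"
  assumes A: "A \<in> carrier_mat m n" and rank: "vec_space.rank m A = n"
    and zero: "\<And>i. i < m \<Longrightarrow> (\<Sum>j<n. A $$ (i, j) * h j) = 0" and "j < n"
  shows "h j = 0"
proof (rule ccontr)
  assume "h j \<noteq> 0"
  interpret vec_space "TYPE(real)" m .
  have cols: "set (cols A) \<subseteq> carrier_vec m"
    using A cols_dim by blast
  have "distinct (cols A)"
  proof (rule card_distinct)
    obtain T where T: "maximal T (\<lambda>T. T \<subseteq> set (cols A) \<and> lin_indpt T)"
      using maximal_exists[of "\<lambda>T. T \<subseteq> set (cols A) \<and> lin_indpt T" "card (set (cols A))" "{}"]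
      by (meson List.finite_set card_mono empty_iff empty_subsetI finite_lin_indpt2 rev_finite_subset)
    then have "T \<subseteq> set (cols A)"
      by (simp add: maximal_def)
    then have "n \<le> card (set (cols A))"
      using rank_card_indpt[OF A T] rank by (simp add: card_mono)
    then show "card (set (cols A)) = length (cols A)"
      using A card_length[of "cols A"] by simp
  qed
  moreover have "A *\<^sub>v vec n h = 0\<^sub>v m"
    using A zero by (intro eq_vecI) (auto simp: scalar_prod_def atLeast0LessThan)
  moreover have "vec n h \<noteq> 0\<^sub>v n"
    using \<open>h j \<noteq> 0\<close> \<open>j < n\<close> by (metis index_vec index_zero_vec(1))
  ultimately have "lin_dep (set (cols A))"
    by (intro lin_depI[OF A, of "vec n h"]) auto
  then show False
    using full_rank_lin_indpt[OF A rank \<open>distinct (cols A)\<close>] by blast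
qed

lemma mat_inv_correct:
  assumes A: "A \<in> carrier_mat n n" and "det A \<noteq> 0"
  shows "mat_inv A \<in> carrier_mat n n" "mat_inv A * A = 1\<^sub>m n" "A * mat_inv A = 1\<^sub>m n"
proof -
  have "A \<in> Units (ring_mat TYPE(real) n ())"
    by (rule det_non_zero_imp_unit[OF A \<open>det A \<noteq> 0\<close>])
  then obtain X where "mat_inverse A = Some X"
    using mat_inverse(1)[OF A, of "()"] by (cases "mat_inverse A") auto
  then show "mat_inv A \<in> carrier_mat n n" "mat_inv A * A = 1\<^sub>m n" "A * mat_inv A = 1\<^sub>m n"
    using mat_inverse(2)[OF A] by (auto simp: mat_inv_def)
qed

lemma det_nonzeroI:
  fixes A :: "real mat"
  assumes A: "A \<in> carrier_mat n n"
    and inj: "\<And>h j. (\<And>i. i < n \<Longrightarrow> (\<Sum>j<n. A $$ (i, j) * h j) = 0) \<Longrightarrow> j < n \<Longrightarrow> h j = 0"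
  shows "det A \<noteq> 0"
proof
  assume "det A = 0"
  then obtain v where v: "v \<in> carrier_vec n" "v \<noteq> 0\<^sub>v n" "A *\<^sub>v v = 0\<^sub>v n"
    using det_0_iff_vec_prod_zero_field[OF A] by blast
  have "(\<Sum>j<n. A $$ (i, j) * v $ j) = 0" if "i < n" for i
  proof -
    have "(A *\<^sub>v v) $ i = 0"
      using v(3) that by simp
    then show ?thesis
      using A v(1) that by (simp add: scalar_prod_def atLeast0LessThan)
  qed
  then have "v $ j = 0" if "j < n" for j
    using inj[of "\<lambda>j. v $ j" j] that by blast
  then have "v = 0\<^sub>v n"
    using v(1) by (intro eq_vecI) auto
  with v(2) show False
    by blast
qed

lemma linear_system_solvable:
  fixes A :: "real mat"
  assumes A: "A \<in> carrier_mat n n" and "det A \<noteq> 0"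
  obtains y where "\<And>i. i < n \<Longrightarrow> (\<Sum>j<n. A $$ (i, j) * y j) = c i"
proof -
  define v where "v = mat_inv A *\<^sub>v vec n c"
  note inv = mat_inv_correct[OF assms]
  have v: "v \<in> carrier_vec n"
    using inv(1) by (simp add: v_def)
  have "A *\<^sub>v v = (A * mat_inv A) *\<^sub>v vec n c"
    unfolding v_def using A inv(1) by (intro assoc_mult_mat_vec[symmetric]) auto
  then have eq: "A *\<^sub>v v = vec n c"
    by (simp add: inv(3))
  have "(\<Sum>j<n. A $$ (i, j) * v $ j) = c i" if "i < n" for i
    using arg_cong[OF eq, of "\<lambda>y. y $ i"] A v that by (simp add: scalar_prod_def atLeast0LessThan)
  then show thesis
    by (rule that)
qed

lemma sum_eq_scalar_prod:
  fixes M :: "real mat"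
  assumes "M \<in> carrier_mat r c" "i < r"
  shows "(M *\<^sub>v vec c z) $ i = (\<Sum>j<c. M $$ (i, j) * z j)"
  using assms by (simp add: scalar_prod_def atLeast0LessThan)

lemma sum_squares_eq_scalar_prod:
  fixes v :: "real vec"
  assumes "v \<in> carrier_vec r"
  shows "v \<bullet> v = (\<Sum>i<r. (v $ i)\<^sup>2)"
  using assms by (simp add: scalar_prod_def atLeast0LessThan power2_eq_square)

text \<open>
  Stated for a general number \<open>q\<close> of trailing columns, because it is applied both to \<open>[A, b]\<close> and to \<open>A\<close>.
\<close>

locale block_triangular =
  fixes m p q :: nat and M Q R11 S C :: "real mat"
  assumes M: "M \<in> carrier_mat m (p + q)" and Q: "Q \<in> carrier_mat m m" and orth: "Q\<^sup>T * Q = 1\<^sub>m m"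
    and le: "p \<le> m"
    and R11: "R11 \<in> carrier_mat p p" and S: "S \<in> carrier_mat p q" and C: "C \<in> carrier_mat (m - p) q"
    and QM: "Q\<^sup>T * M = four_block_mat R11 S (0\<^sub>m (m - p) p) C"
begin

lemma orth': "Q * Q\<^sup>T = 1\<^sub>m m"
  using mat_mult_left_right_inverse[OF _ _ orth] Q by auto

lemma sum_squares_block:
  "(\<Sum>i<m. (\<Sum>j<p + q. M $$ (i, j) * z j)\<^sup>2) =
     (\<Sum>i<p. ((\<Sum>j<p. R11 $$ (i, j) * z j) + (\<Sum>j<q. S $$ (i, j) * z (p + j)))\<^sup>2)
     + (\<Sum>i<m - p. (\<Sum>j<q. C $$ (i, j) * z (p + j))\<^sup>2)"
proof -
  define v where "v = vec (p + q) z"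
  define y where "y = M *\<^sub>v v"
  have v: "v \<in> carrier_vec (p + q)" and y: "y \<in> carrier_vec m"
    using M by (auto simp: v_def y_def)
  have Qy: "Q\<^sup>T *\<^sub>v y \<in> carrier_vec m"
    using Q y by auto
  have R: "Q\<^sup>T * M \<in> carrier_mat m (p + q)"
    using Q M by auto
  have "(Q\<^sup>T *\<^sub>v y) \<bullet> (Q\<^sup>T *\<^sub>v y) = y \<bullet> (Q *\<^sub>v (Q\<^sup>T *\<^sub>v y))"
    by (rule transpose_vec_mult_scalar[OF Q Qy y])
  also have "Q *\<^sub>v (Q\<^sup>T *\<^sub>v y) = (Q * Q\<^sup>T) *\<^sub>v y"
    using Q y by (intro assoc_mult_mat_vec[symmetric]) auto
  also have "\<dots> = y"
    using y by (simp add: orth')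
  finally have "y \<bullet> y = (Q\<^sup>T *\<^sub>v y) \<bullet> (Q\<^sup>T *\<^sub>v y)"
    by simp
  also have "Q\<^sup>T *\<^sub>v y = (Q\<^sup>T * M) *\<^sub>v v"
    unfolding y_def using Q M v by (intro assoc_mult_mat_vec[symmetric]) auto
  finally have "y \<bullet> y = ((Q\<^sup>T * M) *\<^sub>v v) \<bullet> ((Q\<^sup>T * M) *\<^sub>v v)" .
  moreover have "y \<bullet> y = (\<Sum>i<m. (\<Sum>j<p + q. M $$ (i, j) * z j)\<^sup>2)"
    unfolding sum_squares_eq_scalar_prod[OF y]
    by (intro sum.cong refl) (simp add: y_def v_def sum_eq_scalar_prod[OF M])
  moreover have "((Q\<^sup>T * M) *\<^sub>v v) \<bullet> ((Q\<^sup>T * M) *\<^sub>v v) = (\<Sum>i<m. (\<Sum>j<p + q. (Q\<^sup>T * M) $$ (i, j) * z j)\<^sup>2)"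
  proof -
    have "(Q\<^sup>T * M) *\<^sub>v v \<in> carrier_vec m"
      using R v by (rule mult_mat_vec_carrier)
    from sum_squares_eq_scalar_prod[OF this] show ?thesis
      using sum_eq_scalar_prod[OF R, of _ z] by (auto simp del: index_mult_mat_vec simp: v_def)
  qed
  moreover have "(\<Sum>i<m. (\<Sum>j<p + q. (Q\<^sup>T * M) $$ (i, j) * z j)\<^sup>2)
     = (\<Sum>i<p. (\<Sum>j<p + q. (Q\<^sup>T * M) $$ (i, j) * z j)\<^sup>2)
       + (\<Sum>i<m - p. (\<Sum>j<p + q. (Q\<^sup>T * M) $$ (p + i, j) * z j)\<^sup>2)"
    using sum_lessThan_split[of "\<lambda>i. (\<Sum>j<p + q. (Q\<^sup>T * M) $$ (i, j) * z j)\<^sup>2" p "m - p"] le by simp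
  moreover have "(\<Sum>j<p + q. (Q\<^sup>T * M) $$ (i, j) * z j)
      = (\<Sum>j<p. R11 $$ (i, j) * z j) + (\<Sum>j<q. S $$ (i, j) * z (p + j))" if "i < p" for i
    unfolding QM sum_lessThan_split using that R11 S C by simp
  moreover have "(\<Sum>j<p + q. (Q\<^sup>T * M) $$ (p + i, j) * z j) = (\<Sum>j<q. C $$ (i, j) * z (p + j))"
    if "i < m - p" for i
    unfolding QM sum_lessThan_split using that R11 S C by simp
  ultimately show ?thesis
    by simp
qed

abbreviation "W \<equiv> four_block_mat (0\<^sub>m p p) (0\<^sub>m p q) (0\<^sub>m q p) (1\<^sub>m q) :: real mat"

text \<open>
  The pencil factors as
  \<open>[R\<^sub>1\<^sub>1\<^sup>T, 0; S\<^sup>T, I] [R\<^sub>1\<^sub>1, S; 0, C\<^sup>T C - s I]\<close>.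
\<close>

lemma det_pencil:
  "det (M\<^sup>T * M - s \<cdot>\<^sub>m W) = (det R11)\<^sup>2 * det (C\<^sup>T * C - s \<cdot>\<^sub>m 1\<^sub>m q)"
proof -
  have C0: "0\<^sub>m (m - p) p \<in> carrier_mat (m - p) p"
    by simp
  define R where "R = four_block_mat R11 S (0\<^sub>m (m - p) p) C"
  have R: "R \<in> carrier_mat m (p + q)"
    using R11 C le four_block_carrier_mat[OF R11 C] by (simp add: R_def)
  have "M\<^sup>T * M = M\<^sup>T * (Q * Q\<^sup>T * M)"
    using M by (simp add: orth')
  also have "\<dots> = (M\<^sup>T * Q) * (Q\<^sup>T * M)"
    using M Q assoc_mult_mat[of "M\<^sup>T" "p + q" m Q m "Q\<^sup>T * M" "p + q"] by simp
  also have "M\<^sup>T * Q = (Q\<^sup>T * M)\<^sup>T"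
    using M Q by (subst transpose_mult[of "Q\<^sup>T" m m]) auto
  finally have "M\<^sup>T * M = R\<^sup>T * R"
    by (simp add: QM R_def)
  also have "R\<^sup>T = four_block_mat (R11\<^sup>T) (0\<^sub>m p (m - p)) (S\<^sup>T) (C\<^sup>T)"
    unfolding R_def by (subst transpose_four_block_mat[OF R11 S C0 C]) simp
  also have "\<dots> * R = four_block_mat (R11\<^sup>T * R11) (R11\<^sup>T * S) (S\<^sup>T * R11) (S\<^sup>T * S + C\<^sup>T * C)"
    unfolding R_def using R11 S C by (subst mult_four_block_mat[of _ p p _ "m - p" _ q _ _ p _ q]) auto
  finally have "M\<^sup>T * M - s \<cdot>\<^sub>m W =
      four_block_mat (R11\<^sup>T * R11) (R11\<^sup>T * S) (S\<^sup>T * R11) (S\<^sup>T * S + C\<^sup>T * C - s \<cdot>\<^sub>m 1\<^sub>m q)"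
    using R11 S C by (intro eq_matI) auto
  also have "\<dots> = four_block_mat (R11\<^sup>T) (0\<^sub>m p q) (S\<^sup>T) (1\<^sub>m q)
      * four_block_mat R11 S (0\<^sub>m q p) (C\<^sup>T * C - s \<cdot>\<^sub>m 1\<^sub>m q)"
  proof -
    have "S\<^sup>T * S + (C\<^sup>T * C - s \<cdot>\<^sub>m 1\<^sub>m q) = S\<^sup>T * S + C\<^sup>T * C - s \<cdot>\<^sub>m 1\<^sub>m q"
      using S C by (intro eq_matI) auto
    then show ?thesis
      using R11 S C by (subst mult_four_block_mat[of _ p p _ q _ q _ _ p _ q]) auto
  qed
  finally have pencil: "M\<^sup>T * M - s \<cdot>\<^sub>m W = four_block_mat (R11\<^sup>T) (0\<^sub>m p q) (S\<^sup>T) (1\<^sub>m q)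
      * four_block_mat R11 S (0\<^sub>m q p) (C\<^sup>T * C - s \<cdot>\<^sub>m 1\<^sub>m q)" .
  have "det (M\<^sup>T * M - s \<cdot>\<^sub>m W) = det (four_block_mat (R11\<^sup>T) (0\<^sub>m p q) (S\<^sup>T) (1\<^sub>m q))
      * det (four_block_mat R11 S (0\<^sub>m q p) (C\<^sup>T * C - s \<cdot>\<^sub>m 1\<^sub>m q))"
  proof -
    have "four_block_mat (R11\<^sup>T) (0\<^sub>m p q) (S\<^sup>T) (1\<^sub>m q) \<in> carrier_mat (p + q) (p + q)"
      "four_block_mat R11 S (0\<^sub>m q p) (C\<^sup>T * C - s \<cdot>\<^sub>m 1\<^sub>m q) \<in> carrier_mat (p + q) (p + q)"
      using R11 C by (auto intro!: four_block_carrier_mat)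
    then show ?thesis
      unfolding pencil by (rule det_mult)
  qed
  also have "det (four_block_mat (R11\<^sup>T) (0\<^sub>m p q) (S\<^sup>T) (1\<^sub>m q)) = det R11"
    using R11 S by (subst det_four_block_mat_upper_right_zero[of _ p _ q]) (auto simp: det_transpose)
  also have "det (four_block_mat R11 S (0\<^sub>m q p) (C\<^sup>T * C - s \<cdot>\<^sub>m 1\<^sub>m q))
      = det R11 * det (C\<^sup>T * C - s \<cdot>\<^sub>m 1\<^sub>m q)"
    using R11 S C by (subst det_four_block_mat_lower_left_zero[of _ p _ q]) auto
  finally show ?thesis
    by (simp add: power2_eq_square)
qed

lemma gen_char_poly_eq:
  "gen_char_poly (M\<^sup>T * M) W = Polynomial.smult ((-1) ^ q * (det R11)\<^sup>2) (char_poly (C\<^sup>T * C))"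
proof (rule poly_ext)
  fix s :: real
  have "poly (gen_char_poly (M\<^sup>T * M) W) s = det (M\<^sup>T * M - s \<cdot>\<^sub>m W)"
    unfolding gen_char_poly_def using M by (intro poly_det_cong[of _ "p + q"]) auto
  moreover have "poly (char_poly (C\<^sup>T * C)) s = det ((-1) \<cdot>\<^sub>m (C\<^sup>T * C - s \<cdot>\<^sub>m 1\<^sub>m q))"
    unfolding char_poly_def char_poly_matrix_def using C by (intro poly_det_cong[of _ q]) auto
  moreover have "(-1 :: real) ^ q * ((-1) ^ q * c) = c" for c
    by (simp flip: power_mult_distrib mult.assoc)
  ultimately show "poly (gen_char_poly (M\<^sup>T * M) W) s
      = poly (Polynomial.smult ((-1) ^ q * (det R11)\<^sup>2) (char_poly (C\<^sup>T * C))) s"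
    by (simp add: det_pencil det_smult mult.assoc mult.left_commute)
qed

text \<open>
  The degree of the characteristic polynomial of the pencil is \<open>q\<close>, so exactly \<open>p\<close> infinite eigenvalues precede the
  \<open>q\<close> finite ones, which are the eigenvalues of \<open>C\<^sup>T C\<close>.
\<close>

lemma gen_eig_last:
  assumes "0 < q" "det R11 \<noteq> 0"
  shows "gen_eig (p + q) (M\<^sup>T * M) W = ereal (desc_roots (char_poly (C\<^sup>T * C)) ! (q - 1))"
proof -
  have G: "C\<^sup>T * C \<in> carrier_mat q q" "(C\<^sup>T * C)\<^sup>T = C\<^sup>T * C"
    using C by (auto simp: transpose_mult[of "C\<^sup>T" q "m - p" C q])
  define c where "c = (-1) ^ q * (det R11)\<^sup>2"
  have "c \<noteq> 0"
    using assms(2) by (simp add: c_def)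
  then have "degree (gen_char_poly (M\<^sup>T * M) W) = q"
    and "desc_roots (gen_char_poly (M\<^sup>T * M) W) = desc_roots (char_poly (C\<^sup>T * C))"
    unfolding gen_char_poly_eq c_def[symmetric] using degree_monic_char_poly[OF G(1)]
    by (simp_all add: desc_roots_def)
  then show ?thesis
    using M \<open>0 < q\<close> size_proots_char_poly_symmetric[OF G]
    by (simp add: gen_eig_def gen_eigs_def nth_append)
qed

end

context mtls_data
begin

text \<open>
  Let \<open>\<nu> = \<sigma>\<^sup>2\<close> and \<open>C = [R\<^sub>2\<^sub>2, R\<^sub>2\<^sub>b]\<close>. Dropping the first square of the block decomposition shows that
  the form is nonnegative. It vanishes at \<open>z\<close> if the trailing part of \<open>z\<close> is an eigenvector of \<open>C\<^sup>T C\<close> for \<open>\<nu>\<close> and the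
  leading part solves a system with matrix \<open>R\<^sub>1\<^sub>1\<close>. For vectors with last entry \<open>0\<close> only \<open>R\<^sub>2\<^sub>2\<close> matters, whose smallest
  eigenvalue exceeds \<open>\<nu>\<close>. So the last entry of \<open>z\<close> is nonzero, and \<open>z\<close> can be scaled.
\<close>

lemma generic_minimizer:
  assumes le: "n1 + n2 \<le> m"
    and full_rank: "vec_space.rank m (A1 @\<^sub>c A2) = n1 + n2"
    and qr: "mtls_qr A1 A2 b Q R11 R12 R1b R22 R2b"
    and generic: "mtls_generic1 R22 R2b \<or> mtls_generic2 A1 A2 b"
  defines "\<sigma> \<equiv> sing_val (n2 + 1) (R22 @\<^sub>c col_mat R2b)"
  obtains z where "minimizer B z" "rayleigh B z = \<sigma>\<^sup>2" "pos_def (\<sigma>\<^sup>2) B"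
proof -
  define M where "M = A1 @\<^sub>c A2 @\<^sub>c col_mat b"
  define S where "S = R12 @\<^sub>c col_mat R1b"
  define C where "C = R22 @\<^sub>c col_mat R2b"
  have Q: "Q \<in> carrier_mat m m" "Q\<^sup>T * Q = 1\<^sub>m m"
    and R11: "R11 \<in> carrier_mat n1 n1" and R12: "R12 \<in> carrier_mat n1 n2" and R1b: "R1b \<in> carrier_vec n1"
    and R22: "R22 \<in> carrier_mat (m - n1) n2" and R2b: "R2b \<in> carrier_vec (m - n1)"
    and QM: "Q\<^sup>T * M = four_block_mat R11 S (0\<^sub>m (m - n1) n1) C"
    using qr A1 A2 b unfolding mtls_qr_def by (auto simp: Let_def M_def S_def C_def)
  have M: "M \<in> carrier_mat m (n1 + (n2 + 1))"
    unfolding M_def by (rule data_carrier)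
  have S: "S \<in> carrier_mat n1 (n2 + 1)" and C: "C \<in> carrier_mat (m - n1) (n2 + 1)"
    unfolding S_def C_def by (intro append_col_carrier R12 R1b R22 R2b)+
  have A: "A1 @\<^sub>c A2 \<in> carrier_mat m (n1 + n2)"
    by (rule append_cols_carrier[OF A1 A2])
  note inj = full_column_rank_imp_injective[OF A full_rank]
  have M_assoc: "M = (A1 @\<^sub>c A2) @\<^sub>c col_mat b"
    unfolding M_def by (rule append_cols_assoc[OF A1 A2 col_mat_carrier[OF b], symmetric])
  have M_left: "M $$ (i, j) = (A1 @\<^sub>c A2) $$ (i, j)" if "i < m" "j < n1 + n2" for i j
    using that by (simp add: M_assoc append_col_index[OF A b])
  interpret full: block_triangular m n1 "n2 + 1" M Q R11 S C
    using le by unfold_locales (use M Q R11 S C QM in auto)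
  have QA: "Q\<^sup>T * (A1 @\<^sub>c A2) = four_block_mat R11 R12 (0\<^sub>m (m - n1) n1) R22"
  proof (rule eq_matI)
    have c: "four_block_mat R11 R12 (0\<^sub>m (m - n1) n1) R22 \<in> carrier_mat (n1 + (m - n1)) (n1 + n2)"
      by (rule four_block_carrier_mat[OF R11 R22])
    then show "dim_row (Q\<^sup>T * (A1 @\<^sub>c A2)) = dim_row (four_block_mat R11 R12 (0\<^sub>m (m - n1) n1) R22)"
      "dim_col (Q\<^sup>T * (A1 @\<^sub>c A2)) = dim_col (four_block_mat R11 R12 (0\<^sub>m (m - n1) n1) R22)"
      using Q A le by auto
    fix i j
    assume "i < dim_row (four_block_mat R11 R12 (0\<^sub>m (m - n1) n1) R22)"
      "j < dim_col (four_block_mat R11 R12 (0\<^sub>m (m - n1) n1) R22)"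
    then have ij: "i < m" "j < n1 + n2"
      using R11 R22 le by auto
    have "(Q\<^sup>T * (A1 @\<^sub>c A2)) $$ (i, j) = (Q\<^sup>T * M) $$ (i, j)"
      using ij Q A M by (simp add: scalar_prod_def M_left)
    also have "\<dots> = four_block_mat R11 S (0\<^sub>m (m - n1) n1) C $$ (i, j)"
      by (simp only: QM)
    also have "\<dots> = four_block_mat R11 R12 (0\<^sub>m (m - n1) n1) R22 $$ (i, j)"
      using ij R11 R12 R22 S C by (auto simp: S_def C_def append_col_index[OF R12 R1b] append_col_index[OF R22 R2b])
    finally show "(Q\<^sup>T * (A1 @\<^sub>c A2)) $$ (i, j) = four_block_mat R11 R12 (0\<^sub>m (m - n1) n1) R22 $$ (i, j)" .
  qed
  interpret left: block_triangular m n1 n2 "A1 @\<^sub>c A2" Q R11 R12 R22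
    using le by unfold_locales (use A Q R11 R12 R22 QA in auto)
  have gram_block: "gram B z z =
     (\<Sum>i<n1. ((\<Sum>j<n1. R11 $$ (i, j) * z j) + (\<Sum>j<n2 + 1. S $$ (i, j) * z (n1 + j)))\<^sup>2)
     + (\<Sum>i<m - n1. (\<Sum>j<n2 + 1. C $$ (i, j) * z (n1 + j))\<^sup>2)" for z
    unfolding full.sum_squares_block[symmetric]
    by (simp add: gram_def res_def mtls_coeff_def M_def power2_eq_square lessThan_Suc_atMost del: sum.lessThan_Suc)
  have wprod_block: "wprod z z = (\<Sum>j<n2 + 1. (z (n1 + j))\<^sup>2)" for z
    by (simp add: wprod_split lessThan_Suc_atMost del: sum.lessThan_Suc)
  have gram_pos: "0 < gram B h h" if h: "h (n1 + n2) = 0" "\<exists>j<n1 + n2. h j \<noteq> 0" for h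
  proof (rule ccontr)
    assume "\<not> 0 < gram B h h"
    then have "gram B h h = 0"
      by (simp add: gram_def sum_nonneg less_le)
    then have "res B h i = 0" if "i < m" for i
      using that by (simp add: gram_def sum_nonneg_eq_0_iff)
    then have "(\<Sum>j<n1 + n2. (A1 @\<^sub>c A2) $$ (i, j) * h j) = 0" if "i < m" for i
      using that h(1) by (simp add: res_def mtls_coeff_def M_left flip: M_def lessThan_Suc_atMost)
    then show False
      using inj h(2) by blast
  qed
  have det: "det R11 \<noteq> 0"
  proof (rule det_nonzeroI[OF R11])
    fix h :: "nat \<Rightarrow> real" and j
    assume zero: "\<And>i. i < n1 \<Longrightarrow> (\<Sum>j<n1. R11 $$ (i, j) * h j) = 0" and "j < n1"
    define g where "g j = (if j < n1 then h j else 0)" for j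
    have "gram B g g = 0"
      by (simp add: gram_block g_def zero)
    show "h j = 0"
    proof (rule ccontr)
      assume "h j \<noteq> 0"
      then have "\<exists>j<n1 + n2. g j \<noteq> 0"
        using \<open>j < n1\<close> by (intro exI[of _ j]) (simp add: g_def)
      then show False
        using gram_pos[of g] \<open>gram B g g = 0\<close> by (simp add: g_def)
    qed
  qed
  define \<nu> where "\<nu> = desc_roots (char_poly (C\<^sup>T * C)) ! n2"
  note \<nu> = last_root_gram_matrix[OF C zero_less_Suc[of n2, unfolded Suc_eq_plus1], unfolded add_diff_cancel_right', folded \<nu>_def]
  have \<sigma>2: "\<sigma>\<^sup>2 = \<nu>"
    using \<nu>(3) by (simp add: \<sigma>_def sing_val_def \<nu>_def C_def)
  have gap: "\<nu> < desc_roots (char_poly (R22\<^sup>T * R22)) ! (n2 - 1)" if "0 < n2"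
    using generic
  proof
    assume "mtls_generic1 R22 R2b"
    then show ?thesis
      using R22 that by (simp add: mtls_generic1_def Let_def sing_val_def \<nu>_def C_def)
  next
    assume gen: "mtls_generic2 A1 A2 b"
    have "mtls_W n1 n2 = left.W"
      by (rule eq_matI) (auto simp: mtls_W_def Let_def)
    moreover have "mtls_W' n1 n2 = full.W"
      by (rule eq_matI) (auto simp: mtls_W'_def mtls_W_def Let_def)
    ultimately have "gen_eig (n1 + (n2 + 1)) (M\<^sup>T * M) full.W < gen_eig (n1 + n2) ((A1 @\<^sub>c A2)\<^sup>T * (A1 @\<^sub>c A2)) left.W"
      using gen A1 A2 by (simp add: mtls_generic2_def Let_def M_assoc)
    then show ?thesis
      using full.gen_eig_last[OF _ det] left.gen_eig_last[OF that det] by (simp add: \<nu>_def)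
  qed
  have pd: "pos_def \<nu> B"
  proof (rule pos_defI)
    fix h :: "nat \<Rightarrow> real"
    assume h: "h (n1 + n2) = 0" "\<exists>j<n1 + n2. h j \<noteq> 0"
    define s where "s = (\<Sum>j<n2. (h (n1 + j))\<^sup>2)"
    have w: "wprod h h = s"
      by (simp add: wprod_block s_def h(1))
    show "0 < form \<nu> B h h"
    proof (cases "s = 0")
      case True
      then show ?thesis
        using gram_pos[OF h] by (simp add: form_def w)
    next
      case False
      then have "0 < n2"
        by (intro gr0I) (simp add: s_def)
      have "0 \<le> s"
        unfolding s_def by (intro sum_nonneg) simp
      with False have "0 < s"
        by simp
      have "desc_roots (char_poly (R22\<^sup>T * R22)) ! (n2 - 1) * s \<le> (\<Sum>i<m - n1. (\<Sum>j<n2. R22 $$ (i, j) * h (n1 + j))\<^sup>2)"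
        unfolding s_def by (rule last_root_gram_matrix(1)[OF R22 \<open>0 < n2\<close>])
      also have "\<dots> = (\<Sum>i<m - n1. (\<Sum>j<n2 + 1. C $$ (i, j) * h (n1 + j))\<^sup>2)"
        by (intro sum.cong refl) (simp add: C_def append_col_index[OF R22 R2b] h(1))
      also have "\<dots> \<le> gram B h h"
        unfolding gram_block by (simp add: sum_nonneg)
      finally have "desc_roots (char_poly (R22\<^sup>T * R22)) ! (n2 - 1) * s \<le> gram B h h" .
      moreover have "\<nu> * s < desc_roots (char_poly (R22\<^sup>T * R22)) ! (n2 - 1) * s"
        using gap[OF \<open>0 < n2\<close>] \<open>0 < s\<close> by simp
      ultimately show ?thesis
        by (simp add: form_def w)
    qed
  qed
  have nonneg: "0 \<le> form \<nu> B y y" for y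
  proof -
    have "\<nu> * wprod y y \<le> (\<Sum>i<m - n1. (\<Sum>j<n2 + 1. C $$ (i, j) * y (n1 + j))\<^sup>2)"
      unfolding wprod_block by (rule \<nu>(1))
    also have "\<dots> \<le> gram B y y"
      unfolding gram_block by (simp add: sum_nonneg)
    finally show ?thesis
      by (simp add: form_def)
  qed
  obtain e where e: "(\<Sum>j<n2 + 1. (e j)\<^sup>2) = 1" "(\<Sum>k<m - n1. (\<Sum>j<n2 + 1. C $$ (k, j) * e j)\<^sup>2) = \<nu>"
    using \<nu>(2) by blast
  obtain y where y: "\<And>i. i < n1 \<Longrightarrow> (\<Sum>j<n1. R11 $$ (i, j) * y j) = - (\<Sum>j<n2 + 1. S $$ (i, j) * e j)"
    using linear_system_solvable[OF R11 det, of "\<lambda>i. - (\<Sum>j<n2 + 1. S $$ (i, j) * e j)"] by blast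
  define z where "z j = (if j < n1 then y j else e (j - n1))" for j
  have null: "form \<nu> B z z = 0"
    unfolding form_def gram_block wprod_block using e y by (simp add: z_def del: sum.lessThan_Suc)
  have last: "z (n1 + n2) \<noteq> 0"
  proof
    assume last: "z (n1 + n2) = 0"
    obtain c where "c > 0" "c * (\<Sum>j\<le>n1 + n2. (z j)\<^sup>2) \<le> 0"
      using pd null last unfolding pos_def_def by metis
    then have "(\<Sum>j\<le>n1 + n2. (z j)\<^sup>2) = 0"
      by (meson antisym mult_le_0_iff not_le sum_nonneg zero_le_power2)
    then have "e j = 0" if "j < n2 + 1" for j
      using that by (auto simp: sum_nonneg_eq_0_iff z_def dest!: bspec[of _ _ "n1 + j"])
    then have "(\<Sum>j<n2 + 1. (e j)\<^sup>2) = 0"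
      by (intro sum.neutral) simp
    with e(1) show False
      by simp
  qed
  define x where "x j = (- 1 / z (n1 + n2)) * z j" for j
  have x_last: "x (n1 + n2) = -1"
    using last by (simp add: x_def)
  have "form \<nu> B x x = 0"
    unfolding x_def form_scale form_scale_left null by simp
  then have "rayleigh B x = \<nu>"
    using wprod_pos[of x] x_last by (simp add: form_def rayleigh_def field_simps)
  moreover from this have "minimizer B x"
    unfolding minimizer_def using x_last nonneg by (simp add: rayleigh_le_iff)
  ultimately show thesis
    using that pd \<sigma>2 by simp
qed

end

section \<open>Bounding the condition numbers\<close>

lemma norm_inf_nonneg: "0 \<le> norm_inf v"
  by (simp add: norm_inf_def)

lemma abs_index_le_norm_inf: "i < dim_vec v \<Longrightarrow> \<bar>v $ i\<bar> \<le> norm_inf v"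
  unfolding norm_inf_def by (rule Max_ge) auto

lemma norm_inf_leI: "0 \<le> c \<Longrightarrow> (\<And>i. i < dim_vec v \<Longrightarrow> \<bar>v $ i\<bar> \<le> c) \<Longrightarrow> norm_inf v \<le> c"
  unfolding norm_inf_def by (subst Max_le_iff) auto

lemma perturbs_mono:
  assumes "\<epsilon> \<le> \<epsilon>'"
  shows "perturbs a \<epsilon> \<subseteq> perturbs a \<epsilon>'"
proof
  fix d assume d: "d \<in> perturbs a \<epsilon>"
  have "\<bar>d $ k\<bar> \<le> \<epsilon>' * \<bar>a $ k\<bar>" if "k < dim_vec a" for k
  proof -
    have "\<bar>d $ k\<bar> \<le> \<epsilon> * \<bar>a $ k\<bar>"
      using d that by (auto simp: perturbs_def less_eq_vec_def)
    also have "\<dots> \<le> \<epsilon>' * \<bar>a $ k\<bar>"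
      using assms by (simp add: mult_right_mono)
    finally show ?thesis .
  qed
  then show "d \<in> perturbs a \<epsilon>'"
    using d by (auto simp: perturbs_def less_eq_vec_def)
qed

text \<open>
  The suprema shrink together with \<open>\<epsilon>\<close>, so the limit is their infimum, and one suitable \<open>\<epsilon>\<close> for each \<open>\<delta>\<close> suffices.
\<close>

lemma Lim_SUP_perturbs_le:
  assumes bound: "\<And>\<delta>. 0 < \<delta> \<Longrightarrow> \<exists>\<epsilon>>0. \<forall>d\<in>perturbs a \<epsilon>. g d \<le> ereal (L + \<delta>)"
  shows "Lim (at_right 0) (\<lambda>\<epsilon>. SUP d\<in>perturbs a \<epsilon>. g d) \<le> ereal L"
proof -
  define s where "s \<epsilon> = (SUP d\<in>perturbs a \<epsilon>. g d)" for \<epsilon>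
  have mono: "s \<epsilon> \<le> s \<epsilon>'" if "\<epsilon> \<le> \<epsilon>'" for \<epsilon> \<epsilon>'
    unfolding s_def using perturbs_mono[OF that] by (rule SUP_subset_mono) simp
  have "(s \<longlongrightarrow> Inf (s ` ({0<..} \<inter> UNIV))) (at 0 within {0<..} \<inter> UNIV)"
  proof (rule Lim_right_bound)
    show "bot \<le> s \<epsilon>" for \<epsilon>
      by simp
  qed (rule mono)
  then have "Lim (at_right 0) s = Inf (s ` {0<..})"
    by (intro tendsto_Lim) simp_all
  also have "\<dots> \<le> ereal L"
  proof (rule ereal_le_epsilon2)
    fix \<delta> :: real assume "0 < \<delta>"
    then obtain \<epsilon> where "\<epsilon> > 0" "\<forall>d\<in>perturbs a \<epsilon>. g d \<le> ereal (L + \<delta>)"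
      using bound by blast
    then have "s \<epsilon> \<le> ereal (L + \<delta>)"
      unfolding s_def by (intro SUP_least) auto
    moreover have "Inf (s ` {0<..}) \<le> s \<epsilon>"
      using \<open>\<epsilon> > 0\<close> by (intro INF_lower) simp
    ultimately show "Inf (s ` {0<..}) \<le> ereal L + ereal \<delta>"
      by simp
  qed
  finally show ?thesis
    by (simp add: s_def[abs_def])
qed

lemma perturbs_relative_size:
  assumes d: "d \<in> perturbs a \<epsilon>" and nz: "\<And>k. k < dim_vec a \<Longrightarrow> a $ k \<noteq> 0" and "0 < \<epsilon>"
  shows "0 < norm_inf (vec_quot d a)" "norm_inf (vec_quot d a) \<le> \<epsilon>"
    "\<And>k. k < dim_vec a \<Longrightarrow> \<bar>d $ k\<bar> \<le> norm_inf (vec_quot d a) * \<bar>a $ k\<bar>"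
proof -
  have dim: "d \<in> carrier_vec (dim_vec a)" and ne: "d \<noteq> 0\<^sub>v (dim_vec a)"
    and le: "\<And>k. k < dim_vec a \<Longrightarrow> \<bar>d $ k\<bar> \<le> \<epsilon> * \<bar>a $ k\<bar>"
    using d by (auto simp: perturbs_def less_eq_vec_def)
  have q: "\<bar>d $ k\<bar> / \<bar>a $ k\<bar> \<le> norm_inf (vec_quot d a)" if "k < dim_vec a" for k
    using abs_index_le_norm_inf[of k "vec_quot d a"] dim that by (simp add: vec_quot_def)
  obtain k where k: "k < dim_vec a" "d $ k \<noteq> 0"
    using ne dim by (metis carrier_vecD eq_vecI index_zero_vec)
  have "0 < \<bar>d $ k\<bar> / \<bar>a $ k\<bar>"
    using k nz by simp
  then show "0 < norm_inf (vec_quot d a)"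
    using q[OF k(1)] by simp
  show "norm_inf (vec_quot d a) \<le> \<epsilon>"
    using le nz dim \<open>0 < \<epsilon>\<close> by (intro norm_inf_leI) (auto simp: vec_quot_def field_simps)
  show "\<bar>d $ k\<bar> \<le> norm_inf (vec_quot d a) * \<bar>a $ k\<bar>" if "k < dim_vec a" for k
    using q[OF that] nz[OF that] by (simp add: field_simps)
qed

text \<open>
  The relative size \<open>\<eta>\<close> of a perturbation is the denominator of both quotients, so a bound linear in \<open>\<eta>\<close> cancels it. The
  error \<open>\<delta>\<close> is absolute in the assumption but relative to the norm or the entries of \<open>\<phi> a\<close> in the
  conclusions, hence the scaling by \<open>norm_inf (\<phi> a)\<close> and by the smallest absolute entry.
\<close>

lemma condition_numbers_le:
  fixes \<phi> :: "real vec \<Rightarrow> real vec" and u :: "real vec"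
  assumes a: "\<And>k. k < dim_vec a \<Longrightarrow> a $ k \<noteq> 0"
    and u: "u \<in> carrier_vec n" and x: "\<phi> a \<in> carrier_vec n" "0 < n" "\<And>j. j < n \<Longrightarrow> \<phi> a $ j \<noteq> 0"
    and sens: "\<And>\<delta>. 0 < \<delta> \<Longrightarrow> \<exists>\<epsilon>>0. \<forall>d\<in>carrier_vec (dim_vec a). \<forall>\<eta>. 0 \<le> \<eta> \<longrightarrow> \<eta> \<le> \<epsilon> \<longrightarrow>
        (\<forall>k<dim_vec a. \<bar>d $ k\<bar> \<le> \<eta> * \<bar>a $ k\<bar>) \<longrightarrow>
        \<phi> (a + d) \<in> carrier_vec n \<and> (\<forall>j<n. \<bar>\<phi> (a + d) $ j - \<phi> a $ j\<bar> \<le> \<eta> * (u $ j + \<delta>))"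
  shows "mixed_cond \<phi> a \<le> ereal (norm_inf u / norm_inf (\<phi> a))"
    and "componentwise_cond \<phi> a \<le> ereal (norm_inf (vec_quot u (vec_abs (\<phi> a))))"
proof -
  have sens': "\<exists>\<epsilon>>0. \<forall>d\<in>perturbs a \<epsilon>. 0 < norm_inf (vec_quot d a) \<and> \<phi> (a + d) \<in> carrier_vec n \<and>
      (\<forall>j<n. \<bar>\<phi> (a + d) $ j - \<phi> a $ j\<bar> \<le> norm_inf (vec_quot d a) * (u $ j + \<delta>))" if \<delta>: "0 < \<delta>" for \<delta>
  proof -
    obtain \<epsilon> where "\<epsilon> > 0" and \<epsilon>: "\<And>d \<eta>. d \<in> carrier_vec (dim_vec a) \<Longrightarrow> 0 \<le> \<eta> \<Longrightarrow> \<eta> \<le> \<epsilon> \<Longrightarrow>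
        (\<forall>k<dim_vec a. \<bar>d $ k\<bar> \<le> \<eta> * \<bar>a $ k\<bar>) \<Longrightarrow>
        \<phi> (a + d) \<in> carrier_vec n \<and> (\<forall>j<n. \<bar>\<phi> (a + d) $ j - \<phi> a $ j\<bar> \<le> \<eta> * (u $ j + \<delta>))"
      using sens[OF \<delta>] by blast
    show ?thesis
    proof (intro exI[of _ \<epsilon>] conjI ballI \<open>\<epsilon> > 0\<close>)
      fix d assume d: "d \<in> perturbs a \<epsilon>"
      note size = perturbs_relative_size[OF d a \<open>\<epsilon> > 0\<close>]
      show "0 < norm_inf (vec_quot d a)"
        by (rule size(1))
      show "\<phi> (a + d) \<in> carrier_vec n"
        "\<forall>j<n. \<bar>\<phi> (a + d) $ j - \<phi> a $ j\<bar> \<le> norm_inf (vec_quot d a) * (u $ j + \<delta>)"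
        using \<epsilon>[of d "norm_inf (vec_quot d a)"] size d by (auto simp: perturbs_def)
    qed
  qed
  have X: "0 < norm_inf (\<phi> a)"
    using abs_index_le_norm_inf[of 0 "\<phi> a"] x by fastforce
  show "mixed_cond \<phi> a \<le> ereal (norm_inf u / norm_inf (\<phi> a))"
    unfolding mixed_cond_def
  proof (rule Lim_SUP_perturbs_le)
    fix \<delta> :: real assume "0 < \<delta>"
    then have \<delta>: "0 < \<delta> * norm_inf (\<phi> a)"
      using X by simp
    obtain \<epsilon> where "\<epsilon> > 0" and \<epsilon>: "\<forall>d\<in>perturbs a \<epsilon>. 0 < norm_inf (vec_quot d a) \<and> \<phi> (a + d) \<in> carrier_vec n \<and>
      (\<forall>j<n. \<bar>\<phi> (a + d) $ j - \<phi> a $ j\<bar> \<le> norm_inf (vec_quot d a) * (u $ j + \<delta> * norm_inf (\<phi> a)))"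
      using sens'[OF \<delta>] by blast
    have "norm_inf (\<phi> (a + d) - \<phi> a) / norm_inf (\<phi> a) / norm_inf (vec_quot d a) \<le> norm_inf u / norm_inf (\<phi> a) + \<delta>"
      if "d \<in> perturbs a \<epsilon>" for d
    proof -
      define \<eta> where "\<eta> = norm_inf (vec_quot d a)"
      have \<eta>: "0 < \<eta>" and c: "\<phi> (a + d) \<in> carrier_vec n"
        and le: "\<And>j. j < n \<Longrightarrow> \<bar>\<phi> (a + d) $ j - \<phi> a $ j\<bar> \<le> \<eta> * (u $ j + \<delta> * norm_inf (\<phi> a))"
        using \<epsilon> that by (auto simp: \<eta>_def)
      have "norm_inf (\<phi> (a + d) - \<phi> a) \<le> \<eta> * (norm_inf u + \<delta> * norm_inf (\<phi> a))"
      proof (rule norm_inf_leI)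
        show "0 \<le> \<eta> * (norm_inf u + \<delta> * norm_inf (\<phi> a))"
          using \<eta> \<open>0 < \<delta>\<close> by (intro mult_nonneg_nonneg add_nonneg_nonneg norm_inf_nonneg) auto
        fix j assume "j < dim_vec (\<phi> (a + d) - \<phi> a)"
        then have j: "j < n"
          using x c by simp
        have "\<bar>\<phi> (a + d) $ j - \<phi> a $ j\<bar> \<le> \<eta> * (u $ j + \<delta> * norm_inf (\<phi> a))"
          by (rule le[OF j])
        also have "\<dots> \<le> \<eta> * (norm_inf u + \<delta> * norm_inf (\<phi> a))"
          using abs_index_le_norm_inf[of j u] j u \<eta> by (intro mult_left_mono add_right_mono) auto
        finally show "\<bar>(\<phi> (a + d) - \<phi> a) $ j\<bar> \<le> \<eta> * (norm_inf u + \<delta> * norm_inf (\<phi> a))"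
          using j x c by simp
      qed
      then show ?thesis
        using X \<eta> unfolding \<eta>_def[symmetric] by (simp add: field_simps)
    qed
    then show "\<exists>\<epsilon>>0. \<forall>d\<in>perturbs a \<epsilon>.
        ereal (norm_inf (\<phi> (a + d) - \<phi> a) / norm_inf (\<phi> a) / norm_inf (vec_quot d a))
          \<le> ereal (norm_inf u / norm_inf (\<phi> a) + \<delta>)"
      using \<open>\<epsilon> > 0\<close> by (intro exI[of _ \<epsilon>]) simp
  qed
  define c where "c = Min ((\<lambda>j. \<bar>\<phi> a $ j\<bar>) ` {..<n})"
  have c_le: "c \<le> \<bar>\<phi> a $ j\<bar>" if "j < n" for j
    unfolding c_def using that by (intro Min_le) auto
  have "0 < c"
    unfolding c_def using x by (subst Min_gr_iff) auto
  show "componentwise_cond \<phi> a \<le> ereal (norm_inf (vec_quot u (vec_abs (\<phi> a))))"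
    unfolding componentwise_cond_def
  proof (rule Lim_SUP_perturbs_le)
    fix \<delta> :: real assume "0 < \<delta>"
    then have \<delta>: "0 < \<delta> * c"
      using \<open>0 < c\<close> by simp
    define N where "N = norm_inf (vec_quot u (vec_abs (\<phi> a)))"
    obtain \<epsilon> where "\<epsilon> > 0" and \<epsilon>: "\<forall>d\<in>perturbs a \<epsilon>. 0 < norm_inf (vec_quot d a) \<and> \<phi> (a + d) \<in> carrier_vec n \<and>
      (\<forall>j<n. \<bar>\<phi> (a + d) $ j - \<phi> a $ j\<bar> \<le> norm_inf (vec_quot d a) * (u $ j + \<delta> * c))"
      using sens'[OF \<delta>] by blast
    have "norm_inf (vec_quot (\<phi> (a + d) - \<phi> a) (\<phi> a)) / norm_inf (vec_quot d a) \<le> N + \<delta>"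
      if "d \<in> perturbs a \<epsilon>" for d
    proof -
      define \<eta> where "\<eta> = norm_inf (vec_quot d a)"
      have \<eta>: "0 < \<eta>" and dim: "\<phi> (a + d) \<in> carrier_vec n"
        and le: "\<And>j. j < n \<Longrightarrow> \<bar>\<phi> (a + d) $ j - \<phi> a $ j\<bar> \<le> \<eta> * (u $ j + \<delta> * c)"
        using \<epsilon> that by (auto simp: \<eta>_def)
      have "norm_inf (vec_quot (\<phi> (a + d) - \<phi> a) (\<phi> a)) \<le> \<eta> * (N + \<delta>)"
      proof (rule norm_inf_leI)
        show "0 \<le> \<eta> * (N + \<delta>)"
          using \<eta> \<open>0 < \<delta>\<close> norm_inf_nonneg by (simp add: N_def)
        fix j assume "j < dim_vec (vec_quot (\<phi> (a + d) - \<phi> a) (\<phi> a))"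
        then have j: "j < n"
          using x dim by (simp add: vec_quot_def)
        have pos: "0 < \<bar>\<phi> a $ j\<bar>"
          using x j by simp
        have "u $ j / \<bar>\<phi> a $ j\<bar> \<le> \<bar>u $ j\<bar> / \<bar>\<phi> a $ j\<bar>"
          by (simp add: divide_right_mono)
        also have "\<dots> \<le> N"
          using abs_index_le_norm_inf[of j "vec_quot u (vec_abs (\<phi> a))"] j u x
          by (simp add: vec_quot_def N_def)
        finally have "u $ j \<le> N * \<bar>\<phi> a $ j\<bar>"
          using pos by (simp add: field_simps)
        moreover have "\<delta> * c \<le> \<delta> * \<bar>\<phi> a $ j\<bar>"
          using c_le[OF j] \<open>0 < \<delta>\<close> by simp
        ultimately have "\<eta> * (u $ j + \<delta> * c) \<le> \<eta> * ((N + \<delta>) * \<bar>\<phi> a $ j\<bar>)"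
          using \<eta> by (intro mult_left_mono) (simp_all add: distrib_right)
        then have "\<bar>\<phi> (a + d) $ j - \<phi> a $ j\<bar> \<le> \<eta> * (N + \<delta>) * \<bar>\<phi> a $ j\<bar>"
          using le[OF j] by (simp add: mult.assoc)
        then show "\<bar>vec_quot (\<phi> (a + d) - \<phi> a) (\<phi> a) $ j\<bar> \<le> \<eta> * (N + \<delta>)"
          using j x dim pos by (simp add: vec_quot_def pos_divide_le_eq)
      qed
      then show ?thesis
        using \<eta> unfolding \<eta>_def[symmetric] by (simp add: pos_divide_le_eq mult.commute)
    qed
    then show "\<exists>\<epsilon>>0. \<forall>d\<in>perturbs a \<epsilon>.
        ereal (norm_inf (vec_quot (\<phi> (a + d) - \<phi> a) (\<phi> a)) / norm_inf (vec_quot d a))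
          \<le> ereal (norm_inf (vec_quot u (vec_abs (\<phi> a))) + \<delta>)"
      using \<open>\<epsilon> > 0\<close> unfolding N_def by (intro exI[of _ \<epsilon>]) simp
  qed
qed

section \<open>The bounds for the MTLS problem\<close>

lemma mtls_data_of_vec:
  assumes v: "v \<in> carrier_vec (m * (n1 + n2 + 1))"
  obtains A1 A2 b where "mtls_data m n1 n2 A1 A2 b" "v = vec_of_mat (A1 @\<^sub>c A2 @\<^sub>c col_mat b)"
    "\<And>i l. i < m \<Longrightarrow> l \<le> n1 + n2 \<Longrightarrow> mtls_coeff A1 A2 b i l = v $ (l * m + i)"
proof -
  define A1 where "A1 = mat m n1 (\<lambda>(i, l). v $ (l * m + i))"
  define A2 where "A2 = mat m n2 (\<lambda>(i, l). v $ ((n1 + l) * m + i))"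
  define b where "b = vec m (\<lambda>i. v $ ((n1 + n2) * m + i))"
  interpret mtls_data m n1 n2 A1 A2 b
    by unfold_locales (simp_all add: A1_def A2_def b_def)
  have entry: "mtls_coeff A1 A2 b i l = v $ (l * m + i)" if il: "i < m" "l \<le> n1 + n2" for i l
  proof -
    consider "l < n1" | "n1 \<le> l" "l - n1 < n2" | "l = n1 + n2"
    proof -
      have "l < n1 \<or> (n1 \<le> l \<and> l - n1 < n2) \<or> l = n1 + n2"
        using il(2) by linarith
      then show ?thesis
        using that by blast
    qed
    then show ?thesis
    proof cases
      case 1
      then show ?thesis
        using coeff(1)[OF that(1), of l] that(1) by (simp add: A1_def)
    next
      case 2
      then show ?thesis
        using coeff(2)[OF that(1), of "l - n1"] that(1) by (simp add: A2_def)
    next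
      case 3
      then show ?thesis
        using coeff(3)[OF that(1)] that(1) by (simp add: b_def)
    qed
  qed
  have "v = vec_of_mat (A1 @\<^sub>c A2 @\<^sub>c col_mat b)"
  proof (rule eq_vecI)
    have dims: "dim_row (A1 @\<^sub>c A2 @\<^sub>c col_mat b) = m" "dim_col (A1 @\<^sub>c A2 @\<^sub>c col_mat b) = n1 + n2 + 1"
      using data_carrier by auto
    show "dim_vec v = dim_vec (vec_of_mat (A1 @\<^sub>c A2 @\<^sub>c col_mat b))"
      using v by (simp add: vec_of_mat_def dims)
    fix k assume "k < dim_vec (vec_of_mat (A1 @\<^sub>c A2 @\<^sub>c col_mat b))"
    then have k: "k < (n1 + n2 + 1) * m"
      by (simp add: vec_of_mat_def dims mult.commute)
    then have "0 < m"
      by (intro gr0I) simp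
    then have "k mod m < m" "k div m \<le> n1 + n2"
      using k less_mult_imp_div_less[OF k] by simp_all
    then have "mtls_coeff A1 A2 b (k mod m) (k div m) = v $ k"
      by (simp add: entry)
    then show "v $ k = vec_of_mat (A1 @\<^sub>c A2 @\<^sub>c col_mat b) $ k"
      using k by (simp add: vec_of_mat_def dims mtls_coeff_def mult.commute)
  qed
  then show thesis
    using that entry mtls_data_axioms by blast
qed

theorem theorem5:
  fixes m n1 n2 n :: nat
    and A1 A2 A Q R11 R12 R22 P H0 W :: "real mat"
    and b R1b R2b x r u :: "real vec"
    and \<sigma> :: real
  assumes A1: "A1 \<in> carrier_mat m n1" and A2: "A2 \<in> carrier_mat m n2" and b: "b \<in> carrier_vec m"
    and n: "n = n1 + n2" "0 < n" "n \<le> m"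
    and A: "A = A1 @\<^sub>c A2"
    and full_rank: "vec_space.rank m A = n"
    and inconsistent: "\<not> (\<exists>y\<in>carrier_vec n. A *\<^sub>v y = b)"
    and QR: "mtls_qr A1 A2 b Q R11 R12 R1b R22 R2b"
    and generic: "mtls_generic1 R22 R2b \<or> mtls_generic2 A1 A2 b"
    and x: "x = x_mtls A1 A2 b"
    and A_nonzero: "\<forall>i<m. \<forall>j<n. A $$ (i, j) \<noteq> 0"
    and b_nonzero: "\<forall>i<m. b $ i \<noteq> 0"
    and x_nonzero: "\<forall>j<n. x $ j \<noteq> 0"
    and r: "r = A *\<^sub>v x - b"
    and \<sigma>: "\<sigma> = sing_val (n2 + 1) (R22 @\<^sub>c col_mat R2b)"
    and W: "W = mtls_W n1 n2"
    and P: "P = A\<^sup>T * A - \<sigma>\<^sup>2 \<cdot>\<^sub>m W"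
    and H0: "H0 = 1\<^sub>m m - (2 / (norm2 r)\<^sup>2) \<cdot>\<^sub>m (col_mat r * (col_mat r)\<^sup>T)"
    and u: "u = mat_abs (mat_inv P * A\<^sup>T * H0) *\<^sub>v (mat_abs A *\<^sub>v vec_abs x + vec_abs b)
                + mat_abs (mat_inv P) *\<^sub>v (mat_abs (A\<^sup>T) *\<^sub>v vec_abs r)"
  shows "mtls_mixed_cond A1 A2 b \<le> ereal (norm_inf u / norm_inf x)
    \<and> mtls_componentwise_cond A1 A2 b \<le> ereal (norm_inf (vec_quot u (vec_abs x)))"
proof -
  interpret mtls_data m n1 n2 A1 A2 b
    by unfold_locales (rule A1 A2 b)+
  have Ac: "A \<in> carrier_mat m n"
    unfolding A n(1) by (rule append_cols_carrier[OF A1 A2])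
  have le: "n1 + n2 \<le> m" and rank: "vec_space.rank m (A1 @\<^sub>c A2) = n1 + n2"
    using n full_rank by (simp_all add: A)
  obtain z where z: "minimizer B z" and \<mu>: "rayleigh B z = \<sigma>\<^sup>2" and pd: "pos_def (\<sigma>\<^sup>2) B"
    using generic_minimizer[OF le rank QR generic] unfolding \<sigma> by blast
  have last: "z n = -1"
    using z by (simp add: minimizer_def n(1))
  have pd': "pos_def (rayleigh B z) B"
    using pd by (simp add: \<mu>)
  have xz: "x = vec n z"
    unfolding x n(1) using minimizer_unique[OF z pd'] by (intro x_mtls_eq[OF z])
  have xc: "x \<in> carrier_vec n"
    by (simp add: xz)
  have rc: "r \<in> carrier_vec m"
    using Ac xc b by (simp add: r)
  have BA: "B i j = A $$ (i, j)" if "i < m" "j < n" for i j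
    using coeff_left that by (simp add: A n(1))
  have Bb: "B i n = b $ i" if "i < m" for i
    using coeff(3)[OF that] by (simp add: n(1))
  have sum_last: "(\<Sum>l\<le>n1 + n2. f l) = (\<Sum>l<n. f l) + f n" for f :: "nat \<Rightarrow> real"
    by (simp add: n(1) lessThan_Suc_atMost[symmetric])
  have res_r: "res B z i = r $ i" if "i < m" for i
  proof -
    have "r $ i = (\<Sum>j<n. A $$ (i, j) * z j) - b $ i"
      using that Ac b by (simp add: r xz scalar_prod_def atLeast0LessThan)
    then show ?thesis
      using that by (simp add: res_def sum_last BA Bb last)
  qed
  have norm_r: "(norm2 r)\<^sup>2 = gram B z z"
  proof -
    have "r \<bullet> r = gram B z z"
      using rc by (simp add: gram_def res_r scalar_prod_def atLeast0LessThan)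
    moreover have "0 \<le> gram B z z"
      unfolding gram_def by (intro sum_nonneg) simp
    ultimately show ?thesis
      by (simp add: norm2_def)
  qed
  \<comment> \<open>the reflection \<open>H0\<close> needs a nonzero residual\<close>
  have gram_nz: "gram B z z \<noteq> 0"
  proof
    assume "gram B z z = 0"
    then have "r $ i = 0" if "i < m" for i
      using that by (simp add: gram_def sum_nonneg_eq_0_iff res_r)
    then have "(A *\<^sub>v x) $ i = b $ i" if "i < m" for i
      using that Ac b by (simp add: r)
    then have "A *\<^sub>v x = b"
      using Ac b by (intro eq_vecI) auto
    then show False
      using inconsistent xc by blast
  qed
  have Wc: "W \<in> carrier_mat n n"
    by (auto simp: W n(1) mtls_W_def Let_def)
  have Pc: "P \<in> carrier_mat n n"
    unfolding P using Ac Wc by (intro minus_carrier_mat smult_carrier_mat)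
  have P_entry: "entry (\<sigma>\<^sup>2) B k l = P $$ (k, l)" if "k < n" "l < n" for k l
  proof -
    have "W $$ (k, l) = (if k = l then tail_weight n1 k else 0)"
      using that mtls_W_index[of k n1 n2 l] by (simp add: W n(1))
    then show ?thesis
      using that Ac Wc by (simp add: entry_def P BA scalar_prod_def atLeast0LessThan)
  qed
  have detP: "det P \<noteq> 0"
  proof (rule det_nonzeroI[OF Pc])
    fix h :: "nat \<Rightarrow> real" and j
    assume zero: "\<And>i. i < n \<Longrightarrow> (\<Sum>j<n. P $$ (i, j) * h j) = 0" and "j < n"
    define g where "g j = (if j < n then h j else 0)" for j
    have "form (\<sigma>\<^sup>2) B g g = (\<Sum>k<n. \<Sum>l<n. h k * P $$ (k, l) * h l)"
      by (simp add: form_eq_entry sum_last g_def P_entry)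
    also have "\<dots> = (\<Sum>k<n. h k * (\<Sum>l<n. P $$ (k, l) * h l))"
      by (simp add: sum_distrib_left mult.assoc)
    finally have "form (\<sigma>\<^sup>2) B g g = 0"
      by (simp add: zero)
    moreover obtain c where "c > 0"
      and c: "\<And>h. h (n1 + n2) = 0 \<Longrightarrow> c * (\<Sum>j\<le>n1 + n2. (h j)\<^sup>2) \<le> form (\<sigma>\<^sup>2) B h h"
      using pd unfolding pos_def_def by blast
    ultimately have "c * (\<Sum>j\<le>n1 + n2. (g j)\<^sup>2) \<le> 0"
      using c[of g] by (simp add: g_def n(1))
    then have "(\<Sum>j\<le>n1 + n2. (g j)\<^sup>2) = 0"
      using \<open>c > 0\<close> by (meson antisym mult_le_0_iff not_le sum_nonneg zero_le_power2)
    then have "g j = 0"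
      using \<open>j < n\<close> by (simp add: sum_nonneg_eq_0_iff n(1))
    then show "h j = 0"
      using \<open>j < n\<close> by (simp add: g_def)
  qed
  note inv = mat_inv_correct[OF Pc detP]
  define J where "J j k = mat_inv P $$ (j, k)" for j k
  define G where "G j i = (\<Sum>k<n. J j k * B i k)" for j i
  define GH where "GH j i = G j i - 2 * res B z i * (\<Sum>k<m. G j k * res B z k) / gram B z z" for j i
  have J_inv: "(\<Sum>k<n. J j k * entry (rayleigh B z) B k l) = (if j = l then 1 else 0)" if "j < n" "l < n" for j l
  proof -
    have "(\<Sum>k<n. J j k * entry (rayleigh B z) B k l) = (mat_inv P * P) $$ (j, l)"
      using that inv(1) Pc by (simp add: J_def \<mu> P_entry scalar_prod_def atLeast0LessThan)
    then show ?thesis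
      using that by (simp add: inv(2))
  qed
  have G_eq: "(mat_inv P * A\<^sup>T) $$ (j, i) = G j i" if "j < n" "i < m" for j i
    using that inv(1) Ac by (simp add: G_def J_def BA scalar_prod_def atLeast0LessThan)
  have H0c: "H0 \<in> carrier_mat m m"
    using rc by (auto simp: H0 col_mat_def)
  have H0_entry: "H0 $$ (k, i) = (if k = i then 1 else 0) - 2 / gram B z z * (r $ k * r $ i)" if "k < m" "i < m" for k i
    using that rc col_mat_carrier[OF rc] by (simp add: H0 norm_r scalar_prod_def col_mat_index[OF rc])
  have GH_eq: "(mat_inv P * A\<^sup>T * H0) $$ (j, i) = GH j i" if "j < n" "i < m" for j i
  proof -
    have "(mat_inv P * A\<^sup>T * H0) $$ (j, i) = (\<Sum>k<m. (mat_inv P * A\<^sup>T) $$ (j, k) * H0 $$ (k, i))"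
    proof -
      define T where "T = mat_inv P * A\<^sup>T"
      have "T \<in> carrier_mat n m"
        using inv(1) Ac by (simp add: T_def)
      then show ?thesis
        unfolding T_def[symmetric] using that H0c by (simp add: scalar_prod_def atLeast0LessThan)
    qed
    also have "\<dots> = (\<Sum>k<m. (if k = i then G j k else 0) - 2 / gram B z z * r $ i * (G j k * r $ k))"
      using that by (intro sum.cong refl) (simp add: G_eq H0_entry algebra_simps)
    also have "\<dots> = G j i - 2 / gram B z z * r $ i * (\<Sum>k<m. G j k * r $ k)"
      using that by (simp add: sum_subtractf sum_distrib_left)
    also have "\<dots> = GH j i"
      using that by (simp add: GH_def res_r)
    finally show ?thesis .
  qed
  have uc: "u \<in> carrier_vec n"
    using inv(1) by (intro carrier_vecI) (simp add: u)
  have u_eq: "u $ j = (\<Sum>i<m. \<bar>GH j i\<bar> * (\<Sum>l\<le>n1 + n2. \<bar>B i l\<bar> * \<bar>z l\<bar>))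
      + (\<Sum>l<n1 + n2. \<bar>J j l\<bar> * (\<Sum>i<m. \<bar>B i l\<bar> * \<bar>res B z i\<bar>))" if j: "j < n1 + n2" for j
  proof -
    have j': "j < n"
      using j by (simp add: n(1))
    define K where "K = mat_inv P * A\<^sup>T * H0"
    have Kc: "K \<in> carrier_mat n m"
      using inv(1) Ac H0c by (auto simp: K_def)
    have K_entry: "K $$ (j, i) = GH j i" if "i < m" for i
      unfolding K_def using j' that by (rule GH_eq)
    have "u $ j = (\<Sum>i<m. \<bar>K $$ (j, i)\<bar> * ((\<Sum>l<n. \<bar>A $$ (i, l)\<bar> * \<bar>x $ l\<bar>) + \<bar>b $ i\<bar>))
       + (\<Sum>l<n. \<bar>mat_inv P $$ (j, l)\<bar> * (\<Sum>i<m. \<bar>A $$ (i, l)\<bar> * \<bar>r $ i\<bar>))"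
      unfolding u K_def[symmetric] using j' Kc inv(1) Ac xc b rc
      by (simp add: scalar_prod_def atLeast0LessThan)
    also have "(\<Sum>i<m. \<bar>K $$ (j, i)\<bar> * ((\<Sum>l<n. \<bar>A $$ (i, l)\<bar> * \<bar>x $ l\<bar>) + \<bar>b $ i\<bar>))
       = (\<Sum>i<m. \<bar>GH j i\<bar> * (\<Sum>l\<le>n1 + n2. \<bar>B i l\<bar> * \<bar>z l\<bar>))"
      by (intro sum.cong refl) (simp add: K_entry sum_last BA Bb last xz)
    also have "(\<Sum>l<n. \<bar>mat_inv P $$ (j, l)\<bar> * (\<Sum>i<m. \<bar>A $$ (i, l)\<bar> * \<bar>r $ i\<bar>))
       = (\<Sum>l<n1 + n2. \<bar>J j l\<bar> * (\<Sum>i<m. \<bar>B i l\<bar> * \<bar>res B z i\<bar>))"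
      by (intro sum.cong) (simp_all add: n(1) J_def BA res_r)
    finally show ?thesis .
  qed
  define a where "a = vec_of_mat (A1 @\<^sub>c A2 @\<^sub>c col_mat b)"
  have dims: "dim_row (A1 @\<^sub>c A2 @\<^sub>c col_mat b) = m" "dim_col (A1 @\<^sub>c A2 @\<^sub>c col_mat b) = n + 1"
    using data_carrier by (auto simp: n(1))
  have dim_a: "dim_vec a = m * (n + 1)"
    by (simp add: a_def vec_of_mat_def dims)
  have a_entry: "a $ (l * m + i) = B i l" if "i < m" "l \<le> n" for i l
    using that stacked_index_less[of i m l "n + 1"] by (simp add: a_def vec_of_mat_def dims mtls_coeff_def)
  have a_nz: "a $ k \<noteq> 0" if "k < dim_vec a" for k
  proof -
    have k: "k < (n + 1) * m"
      using that by (simp add: dim_a mult.commute)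
    then have "0 < m"
      by (intro gr0I) simp
    then have "k mod m < m" "k div m \<le> n"
      using less_mult_imp_div_less[OF k] by simp_all
    then have "a $ k = B (k mod m) (k div m)"
      using a_entry[of "k mod m" "k div m"] by simp
    then show ?thesis
      using \<open>k mod m < m\<close> \<open>k div m \<le> n\<close> A_nonzero b_nonzero by (cases "k div m = n") (auto simp: BA Bb)
  qed
  define \<phi> where "\<phi> = mtls_map m n1 n2"
  have \<phi>a: "\<phi> a = x"
    unfolding \<phi>_def a_def x by (rule mtls_map_eq)
  \<comment> \<open>perturbed stacked data are again the data of an MTLS problem\<close>
  have sens: "\<exists>\<epsilon>>0. \<forall>d\<in>carrier_vec (dim_vec a). \<forall>\<eta>. 0 \<le> \<eta> \<longrightarrow> \<eta> \<le> \<epsilon> \<longrightarrow>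
        (\<forall>k<dim_vec a. \<bar>d $ k\<bar> \<le> \<eta> * \<bar>a $ k\<bar>) \<longrightarrow>
        \<phi> (a + d) \<in> carrier_vec n \<and> (\<forall>j<n. \<bar>\<phi> (a + d) $ j - \<phi> a $ j\<bar> \<le> \<eta> * (u $ j + \<delta>))" if "0 < \<delta>" for \<delta>
  proof -
    have "\<exists>\<epsilon>>0. \<forall>B' \<eta>. 0 \<le> \<eta> \<longrightarrow> \<eta> \<le> \<epsilon> \<longrightarrow> (\<forall>i<m. \<forall>l\<le>n1 + n2. \<bar>B' i l - B i l\<bar> \<le> \<eta> * \<bar>B i l\<bar>) \<longrightarrow>
      (\<exists>z'. minimizer B' z' \<and> (\<forall>y. minimizer B' y \<longrightarrow> (\<forall>j\<le>n1 + n2. y j = z' j)) \<and>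
         (\<forall>j<n1 + n2. \<bar>z' j - z j\<bar> \<le> \<eta> * (u $ j + \<delta>)))"
      by (rule minimizer_sensitivity[OF z pd' gram_nz, of J G GH "\<lambda>j. u $ j"])
        (use J_inv u_eq that in \<open>simp_all add: n(1) G_def GH_def\<close>)
    then obtain \<epsilon> where "\<epsilon> > 0" and \<epsilon>: "\<And>B' \<eta>. 0 \<le> \<eta> \<Longrightarrow> \<eta> \<le> \<epsilon> \<Longrightarrow>
        (\<forall>i<m. \<forall>l\<le>n1 + n2. \<bar>B' i l - B i l\<bar> \<le> \<eta> * \<bar>B i l\<bar>) \<Longrightarrow>
      (\<exists>z'. minimizer B' z' \<and> (\<forall>y. minimizer B' y \<longrightarrow> (\<forall>j\<le>n1 + n2. y j = z' j)) \<and>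
         (\<forall>j<n1 + n2. \<bar>z' j - z j\<bar> \<le> \<eta> * (u $ j + \<delta>)))"
      by blast
    have "\<phi> (a + d) \<in> carrier_vec n \<and> (\<forall>j<n. \<bar>\<phi> (a + d) $ j - \<phi> a $ j\<bar> \<le> \<eta> * (u $ j + \<delta>))"
      if d: "d \<in> carrier_vec (dim_vec a)" and \<eta>: "0 \<le> \<eta>" "\<eta> \<le> \<epsilon>"
        and small: "\<forall>k<dim_vec a. \<bar>d $ k\<bar> \<le> \<eta> * \<bar>a $ k\<bar>" for d \<eta>
    proof -
      have "a + d \<in> carrier_vec (m * (n1 + n2 + 1))"
        using d dim_a by (intro carrier_vecI) (simp add: n(1))
      then obtain A1' A2' b' where data: "mtls_data m n1 n2 A1' A2' b'"
        and ad: "a + d = vec_of_mat (A1' @\<^sub>c A2' @\<^sub>c col_mat b')"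
        and entry': "\<And>i l. i < m \<Longrightarrow> l \<le> n1 + n2 \<Longrightarrow> mtls_coeff A1' A2' b' i l = (a + d) $ (l * m + i)"
        using mtls_data_of_vec by blast
      interpret pert: mtls_data m n1 n2 A1' A2' b'
        by (rule data)
      have "\<bar>pert.B i l - B i l\<bar> \<le> \<eta> * \<bar>B i l\<bar>" if "i < m" "l \<le> n1 + n2" for i l
      proof -
        have k: "l * m + i < dim_vec a"
          using stacked_index_less[of i m l "n + 1"] that by (simp add: dim_a n(1))
        then have "pert.B i l - B i l = d $ (l * m + i)"
          using that d entry' a_entry by (simp add: n(1))
        then show ?thesis
          using small k a_entry[of i l] that by (metis n(1))
      qed
      then obtain z' where z': "minimizer pert.B z'"
        and uniq: "\<And>y j. minimizer pert.B y \<Longrightarrow> j \<le> n1 + n2 \<Longrightarrow> y j = z' j"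
        and close: "\<And>j. j < n1 + n2 \<Longrightarrow> \<bar>z' j - z j\<bar> \<le> \<eta> * (u $ j + \<delta>)"
        using \<epsilon>[OF \<eta>, of pert.B] by blast
      have "\<phi> (a + d) = vec n z'"
        unfolding \<phi>_def ad pert.mtls_map_eq n(1) using z' uniq by (rule pert.x_mtls_eq)
      then show ?thesis
        using close unfolding \<phi>a xz by (simp add: n(1))
    qed
    then show ?thesis
      using \<open>\<epsilon> > 0\<close> by blast
  qed
  have x': "\<phi> a \<in> carrier_vec n" "\<And>j. j < n \<Longrightarrow> \<phi> a $ j \<noteq> 0"
    using xc x_nonzero by (simp_all add: \<phi>a)
  have "mixed_cond \<phi> a \<le> ereal (norm_inf u / norm_inf (\<phi> a))"
    "componentwise_cond \<phi> a \<le> ereal (norm_inf (vec_quot u (vec_abs (\<phi> a))))"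
    by (rule condition_numbers_le[OF a_nz uc x'(1) n(2) x'(2) sens]; assumption)+
  moreover have "mtls_mixed_cond A1 A2 b = mixed_cond \<phi> a"
    "mtls_componentwise_cond A1 A2 b = componentwise_cond \<phi> a"
    using A1 A2 b by (simp_all add: mtls_mixed_cond_def mtls_componentwise_cond_def \<phi>_def a_def)
  ultimately show ?thesis
    by (simp add: \<phi>a)
qed

end
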